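(* Let $\omega_a:\Lambda(x\|a)\to\Lambda(x\|a')$ be the $\mathbb Q[a]$-linear ring homomorphism with $\omega_a:e_k(x\|a)\mapsto h_k(x\|a')$ for $k=1,2,\dots$. Then $\omega_{a'}\circ\omega_a=\mathrm{id}_{\Lambda(x\|a)}$, and for every partition $\lambda$ $$\omega_a:h_\lambda(x\|a)\mapsto e_\lambda(x\|a').$$
   Context: Let $a=(a_i)_{i\in\mathbb Z}$ be a sequence of commuting indeterminates and $\mathbb Q[a]$ the polynomial ring in the $a_i$. Let $a'$ be the sequence with $(a')_i=-a_{-i+1}$, $i\in\mathbb Z$; then $(a')'=a$, and $\mathbb Q[a']$ is identified with $\mathbb Q[a]$ by replacing each $(a')_i$ with $-a_{-i+1}$. The ring $\Lambda(x\|a)$: its elements are sequences $P=(P_0,P_1,P_2,\dots)$, where $P_n$ is a symmetric polynomial in $x_1,\dots,x_n$ with coefficients in $\mathbb Q[a]$, the total degrees of the $P_n$ in the $x_i$ are bounded, and $P_n(x_1,\dots,x_{n-1},a_n)=P_{n-1}(x_1,\dots,x_{n-1})$ for all $n\geqslant 1$; multiplication is componentwise. $\Lambda(x\|a')$ is the same construction with $a'$ in place of $a$. The double elementary and complete symmetric functions are the elements of $\Lambda(x\|a)$ $$e_k(x\|a)=\sum_{i_1>\dots>i_k}(x_{i_1}-a_{i_1})(x_{i_2}-a_{i_2+1})\cdots(x_{i_k}-a_{i_k+k-1}),\qquad h_k(x\|a)=\sum_{i_1\geqslant\dots\geqslant i_k}(x_{i_1}-a_{i_1})(x_{i_2}-a_{i_2-1})\cdots(x_{i_k}-a_{i_k-k+1})$$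 (indices in $\{1,\dots,n\}$ for the $n$-th component). For $\lambda=(\lambda_1,\dots,\lambda_l)$ put $e_\lambda(x\|a)=e_{\lambda_1}(x\|a)\cdots e_{\lambda_l}(x\|a)$ and $h_\lambda(x\|a)=h_{\lambda_1}(x\|a)\cdots h_{\lambda_l}(x\|a)$. Each of the families $(e_k(x\|a))_{k\geqslant 1}$, $(h_k(x\|a))_{k\geqslant 1}$ is a set of algebraically independent generators of $\Lambda(x\|a)$ over $\mathbb Q[a]$, so $\omega_a$ is well defined: $\omega_a\big(\sum_\lambda c_\lambda(a)e_\lambda(x\|a)\big)=\sum_\lambda c_\lambda(a)h_\lambda(x\|a')$, with $c_\lambda(a)\in\mathbb Q[a]$ regarded as an element of $\mathbb Q[a']$. The map $\omega_{a'}$ is defined in the same way with $a$ and $a'$ interchanged. *)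

theory Defs
  imports
    Complex_Main
    "HOL-Library.Poly_Mapping"
    "HOL-Library.FuncSet"
    "HOL-Combinatorics.Permutations"
begin

text \<open>
  A polynomial in variables from \<open>'v\<close> over \<open>'r\<close> is a finitely supported function from monomials
  (finitely supported exponent functions) to coefficients; the ring structure is the one provided
  by \<^theory>\<open>HOL-Library.Poly_Mapping\<close>.
\<close>

type_synonym ('v, 'r) mpoly = "('v \<Rightarrow>\<^sub>0 nat) \<Rightarrow>\<^sub>0 'r"

definition Var :: "'v \<Rightarrow> ('v, 'r::comm_ring_1) mpoly" where
  "Var v = Poly_Mapping.single (Poly_Mapping.single v 1) 1"

definition Coeff :: "'r \<Rightarrow> ('v, 'r::comm_ring_1) mpoly" where
  "Coeff c = Poly_Mapping.single 0 c"

definition subst :: "('v \<Rightarrow> ('w, 'r) mpoly) \<Rightarrow> ('v, 'r::comm_ring_1) mpoly \<Rightarrow> ('w, 'r) mpoly" where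
  "subst s p = (\<Sum>m\<in>Poly_Mapping.keys p. Coeff (Poly_Mapping.lookup p m) *
     (\<Prod>v\<in>Poly_Mapping.keys m. s v ^ Poly_Mapping.lookup m v))"

text \<open>
  \<open>qa\<close> is the ring $\mathbb Q[a]$, with \<open>indet i\<close> the indeterminate $a_i$. The ring
  $\mathbb Q[a']$ is identified with it, so the sequence $a'$ is the sequence
  \<open>dual_seq indet\<close> of elements of \<open>qa\<close>. The constructions below take as parameter an arbitrary
  sequence \<open>b\<close> in \<open>qa\<close>, and are used for $b = a$ and $b = a'$.
\<close>

type_synonym qa = "(int, rat) mpoly"

definition indet :: "int \<Rightarrow> qa" where
  "indet i = Var i"

definition dual_seq :: "(int \<Rightarrow> qa) \<Rightarrow> int \<Rightarrow> qa" where
  "dual_seq b i = - b (- i + 1)"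

text \<open>The variable $x_i$ is \<open>Var i\<close>; only the indices $i \geq 1$ are used.\<close>

type_synonym xpoly = "(nat, qa) mpoly"

definition symmetric_poly :: "nat \<Rightarrow> xpoly \<Rightarrow> bool" where
  "symmetric_poly n p \<longleftrightarrow>
     (\<forall>m\<in>Poly_Mapping.keys p. Poly_Mapping.keys m \<subseteq> {1..n}) \<and>
     (\<forall>\<pi>. \<pi> permutes {1..n} \<longrightarrow> subst (\<lambda>i. Var (\<pi> i)) p = p)"

text \<open>The carrier of the ring $\Lambda(x\|b)$; its ring operations are componentwise.\<close>

definition Lam :: "(int \<Rightarrow> qa) \<Rightarrow> (nat \<Rightarrow> xpoly) set" where
  "Lam b = {P. (\<forall>n. symmetric_poly n (P n)) \<and>
     (\<exists>d. \<forall>n. \<forall>m\<in>Poly_Mapping.keys (P n).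
        (\<Sum>i\<in>Poly_Mapping.keys m. Poly_Mapping.lookup m i) \<le> d) \<and>
     (\<forall>n\<ge>1. subst (Var(n := Coeff (b (int n)))) (P n) = P (n - 1))}"

text \<open>
  In the next two definitions a list \<open>is\<close> is the index sequence $(i_1,\dots,i_k)$, but its
  entries are counted from \<open>0\<close>: $i_{j+1}$ is \<open>is ! j\<close>.
\<close>

definition double_e :: "nat \<Rightarrow> (int \<Rightarrow> qa) \<Rightarrow> nat \<Rightarrow> xpoly" where
  "double_e k b n =
     (\<Sum>is\<in>{is. length is = k \<and> set is \<subseteq> {1..n} \<and> sorted_wrt (>) is}.
        \<Prod>j<k. Var (is ! j) - Coeff (b (int (is ! j) + int j)))"

definition double_h :: "nat \<Rightarrow> (int \<Rightarrow> qa) \<Rightarrow> nat \<Rightarrow> xpoly" where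
  "double_h k b n =
     (\<Sum>is\<in>{is. length is = k \<and> set is \<subseteq> {1..n} \<and> sorted_wrt (\<ge>) is}.
        \<Prod>j<k. Var (is ! j) - Coeff (b (int (is ! j) - int j)))"

definition is_partition :: "nat list \<Rightarrow> bool" where
  "is_partition l \<longleftrightarrow> sorted_wrt (\<ge>) l \<and> 0 \<notin> set l"

definition double_e_part :: "nat list \<Rightarrow> (int \<Rightarrow> qa) \<Rightarrow> nat \<Rightarrow> xpoly" where
  "double_e_part l b n = (\<Prod>k\<leftarrow>l. double_e k b n)"

definition double_h_part :: "nat list \<Rightarrow> (int \<Rightarrow> qa) \<Rightarrow> nat \<Rightarrow> xpoly" where
  "double_h_part l b n = (\<Prod>k\<leftarrow>l. double_h k b n)"

definition Lam_hom ::
    "(int \<Rightarrow> qa) \<Rightarrow> (int \<Rightarrow> qa) \<Rightarrow> ((nat \<Rightarrow> xpoly) \<Rightarrow> (nat \<Rightarrow> xpoly)) \<Rightarrow> bool" where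
  "Lam_hom b c f \<longleftrightarrow> f \<in> Lam b \<rightarrow> Lam c \<and>
     f (\<lambda>n. 1) = (\<lambda>n. 1) \<and>
     (\<forall>P\<in>Lam b. \<forall>Q\<in>Lam b. f (\<lambda>n. P n + Q n) = (\<lambda>n. f P n + f Q n)) \<and>
     (\<forall>P\<in>Lam b. \<forall>Q\<in>Lam b. f (\<lambda>n. P n * Q n) = (\<lambda>n. f P n * f Q n)) \<and>
     (\<forall>r. \<forall>P\<in>Lam b. f (\<lambda>n. Coeff r * P n) = (\<lambda>n. Coeff r * f P n))"

text \<open>
  The homomorphism $\omega_b$. The condition \<open>extensional\<close> fixes the irrelevant values outside
  \<open>Lam b\<close>, so that uniqueness on \<open>Lam b\<close> is uniqueness as a HOL function.
\<close>

definition omega :: "(int \<Rightarrow> qa) \<Rightarrow> (nat \<Rightarrow> xpoly) \<Rightarrow> (nat \<Rightarrow> xpoly)" where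
  "omega b = (THE f. f \<in> extensional (Lam b) \<and> Lam_hom b (dual_seq b) f \<and>
     (\<forall>k\<ge>1. f (double_e k b) = double_h k (dual_seq b)))"

end

theory Submission
  imports Defs "HOL-Computational_Algebra.Formal_Power_Series"
begin

text \<open>
  Put $u(t) = \prod_i (1 + x_i t)/(1 + b_i t)$ and $v(t) = \prod_i (1 - b_i t)/(1 - x_i t)$.
  Then $u(t) = \sum_k e_k(x\|b)\, t^k / ((1 + b_1 t) \cdots (1 + b_k t))$, and
  $v(t)$ for $b'$ has the same expansion with $h_k(x\|b')$ in place of $e_k(x\|b)$. Both
  expansions are unitriangular, so $\omega_b$ maps the coefficients of $u$ for $b$ to those of $v$
  for $b'$. Since $u(t)\, v(-t) = 1$, it maps the coefficients of $v$ for $b$ to those of $u$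
  for $b'$, hence $h_k(x\|b)$ to $e_k(x\|b')$.

  That $\omega_b$ exists and is unique is the fundamental theorem of symmetric polynomials for the
  generators $e_k(x\|b)$: in the graded lexicographic order, the leading monomial of $e_k(x\|b)$
  in $n \geq k$ variables is $x_1 \cdots x_k$. The finite case passes to sequences because a
  symmetric polynomial of degree at most $d$ involves only $e_1, \dots, e_d$, whatever $n$ is.
\<close>

text \<open>The form of \<open>a'\<close> is dictated by the two recurrences. One more variable
  shifts \<open>b\<close> up in the recurrence for e_k and down in the one for h_k; passing to b'
  exchanges the two shifts and gives - b'_1 = b_0. Hence v(t) for b expands along the denominators
  of b', and v(t) for b' along those of b'' = b, as u(t) for b does. The expansion coefficients lie
  in Q[a] and do not depend on the number of variables, so a Q[a]-linear map on sequences can be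
  applied to the expansions. The symmetry of e_k and h_k, which membership in \<open>Lam\<close>
  demands, is invisible in their definition, since the index of \<open>b\<close> depends on the
  position in the index sequence. It is visible in the products u and v, and the unitriangular
  relation carries it back. So the series serve both for the symmetry and for the action of
  \<omega>.\<close>

unbundle fps_syntax

subsection \<open>Substitution in polynomials\<close>

lemma Coeff_add: "Coeff (a + b) = Coeff a + Coeff b"
  by (simp add: Coeff_def single_add)

lemma Coeff_mult: "Coeff (a * b) = Coeff a * Coeff b"
  by (simp add: Coeff_def mult_single)

lemma Coeff_0 [simp]: "Coeff 0 = 0"
  by (simp add: Coeff_def)

lemma Coeff_1 [simp]: "Coeff 1 = 1"
  by (simp add: Coeff_def)

lemma Coeff_uminus: "Coeff (- a) = - Coeff a"
  by (simp add: Coeff_def single_uminus)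

lemma Coeff_sum: "Coeff (\<Sum>i\<in>I. f i) = (\<Sum>i\<in>I. Coeff (f i))"
  by (induction I rule: infinite_finite_induct) (simp_all add: Coeff_add)

lemma Coeff_power: "Coeff (a ^ n) = Coeff a ^ n"
  by (induction n) (simp_all add: Coeff_mult)

lemma poly_mapping_sum_monomials:
  "p = (\<Sum>m\<in>Poly_Mapping.keys p. Poly_Mapping.single m (Poly_Mapping.lookup p m))"
proof (rule poly_mapping_eqI)
  fix k
  show "Poly_Mapping.lookup p k =
    Poly_Mapping.lookup (\<Sum>m\<in>Poly_Mapping.keys p. Poly_Mapping.single m (Poly_Mapping.lookup p m)) k"
    by (simp add: lookup_sum lookup_single when_def in_keys_iff)
qed

definition monom_eval :: "('v \<Rightarrow> 'b::comm_monoid_mult) \<Rightarrow> ('v \<Rightarrow>\<^sub>0 nat) \<Rightarrow> 'b" where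
  "monom_eval s m = (\<Prod>v\<in>Poly_Mapping.keys m. s v ^ Poly_Mapping.lookup m v)"

lemma monom_eval_superset:
  assumes "finite A" "Poly_Mapping.keys m \<subseteq> A"
  shows "monom_eval s m = (\<Prod>v\<in>A. s v ^ Poly_Mapping.lookup m v)"
  unfolding monom_eval_def
  by (rule prod.mono_neutral_left) (use assms in \<open>auto simp: in_keys_iff\<close>)

lemma monom_eval_0 [simp]: "monom_eval s 0 = 1"
  by (simp add: monom_eval_def)

lemma monom_eval_add: "monom_eval s (m + m') = monom_eval s m * monom_eval s m'"
proof -
  let ?A = "Poly_Mapping.keys m \<union> Poly_Mapping.keys m'"
  have "monom_eval s (m + m') = (\<Prod>v\<in>?A. s v ^ Poly_Mapping.lookup (m + m') v)"
    by (rule monom_eval_superset) (simp_all add: Poly_Mapping.keys_add)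
  also have "\<dots> = (\<Prod>v\<in>?A. s v ^ Poly_Mapping.lookup m v) * (\<Prod>v\<in>?A. s v ^ Poly_Mapping.lookup m' v)"
    by (simp add: lookup_add power_add prod.distrib)
  also have "\<dots> = monom_eval s m * monom_eval s m'"
    using monom_eval_superset[of ?A m s] monom_eval_superset[of ?A m' s] by simp
  finally show ?thesis .
qed

lemma monom_eval_single [simp]: "monom_eval s (Poly_Mapping.single v n) = s v ^ n"
  by (cases "n = 0") (simp_all add: monom_eval_def)

lemma subst_superset:
  assumes "finite A" "Poly_Mapping.keys p \<subseteq> A"
  shows "subst s p = (\<Sum>m\<in>A. Coeff (Poly_Mapping.lookup p m) * monom_eval s m)"
  unfolding subst_def monom_eval_def[symmetric]
  by (rule sum.mono_neutral_left) (use assms in \<open>auto simp: in_keys_iff\<close>)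

lemma subst_single: "subst s (Poly_Mapping.single m c) = Coeff c * monom_eval s m"
  by (subst subst_superset[of "{m}"]) auto

lemma subst_0 [simp]: "subst s 0 = 0"
  by (simp add: subst_def)

lemma subst_add: "subst s (p + q) = subst s p + subst s q"
proof -
  let ?A = "Poly_Mapping.keys p \<union> Poly_Mapping.keys q"
  have "subst s (p + q) = (\<Sum>m\<in>?A. Coeff (Poly_Mapping.lookup (p + q) m) * monom_eval s m)"
    by (rule subst_superset) (simp_all add: Poly_Mapping.keys_add)
  also have "\<dots> = (\<Sum>m\<in>?A. Coeff (Poly_Mapping.lookup p m) * monom_eval s m) +
                  (\<Sum>m\<in>?A. Coeff (Poly_Mapping.lookup q m) * monom_eval s m)"
    by (simp add: lookup_add Coeff_add distrib_right sum.distrib)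
  also have "\<dots> = subst s p + subst s q"
    using subst_superset[of ?A p s] subst_superset[of ?A q s] by simp
  finally show ?thesis .
qed

lemma subst_sum: "subst s (\<Sum>i\<in>I. f i) = (\<Sum>i\<in>I. subst s (f i))"
  by (induction I rule: infinite_finite_induct) (simp_all add: subst_add)

lemma subst_mult: "subst s (p * q) = subst s p * subst s q"
proof -
  let ?t = "\<lambda>p m. Poly_Mapping.single m (Poly_Mapping.lookup p m)"
  have "subst s ((\<Sum>m\<in>Poly_Mapping.keys p. ?t p m) * (\<Sum>m\<in>Poly_Mapping.keys q. ?t q m)) =
     (\<Sum>m\<in>Poly_Mapping.keys p. \<Sum>m'\<in>Poly_Mapping.keys q. subst s (?t p m) * subst s (?t q m'))"
    by (simp add: sum_product subst_sum mult_single subst_single Coeff_mult monom_eval_add mult_ac)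
  also have "\<dots> = subst s (\<Sum>m\<in>Poly_Mapping.keys p. ?t p m) *
      subst s (\<Sum>m\<in>Poly_Mapping.keys q. ?t q m)"
    by (simp only: sum_product subst_sum)
  finally show ?thesis
    using poly_mapping_sum_monomials[of p] poly_mapping_sum_monomials[of q] by argo
qed

lemma subst_Coeff [simp]: "subst s (Coeff c) = Coeff c"
  unfolding Coeff_def by (subst subst_single) (simp add: Coeff_def)

lemma subst_1 [simp]: "subst s 1 = 1"
  using subst_Coeff[of s 1] by simp

lemma subst_Var [simp]: "subst s (Var v) = s v"
  by (simp add: Var_def subst_single)

lemma subst_uminus: "subst s (- p) = - subst s p"
  using subst_add[of s p "- p"] by (simp add: eq_neg_iff_add_eq_0 add.commute)

lemma subst_diff: "subst s (p - q) = subst s p - subst s q"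
  using subst_add[of s p "- q"] by (simp add: subst_uminus)

lemma subst_power: "subst s (p ^ n) = subst s p ^ n"
  by (induction n) (simp_all add: subst_mult)

section \<open>Variables occurring in a polynomial\<close>

definition vars :: "('v, 'r::zero) mpoly \<Rightarrow> 'v set" where
  "vars p = (\<Union>m\<in>Poly_Mapping.keys p. Poly_Mapping.keys m)"

lemma monom_eval_cong:
  "(\<And>v. v \<in> Poly_Mapping.keys m \<Longrightarrow> s v = s' v) \<Longrightarrow> monom_eval s m = monom_eval s' m"
  unfolding monom_eval_def by (rule prod.cong) auto

lemma subst_cong:
  "(\<And>v. v \<in> vars p \<Longrightarrow> s v = s' v) \<Longrightarrow> subst s p = subst s' p"
  unfolding subst_def monom_eval_def[symmetric]
  by (intro sum.cong refl arg_cong2[of _ _ _ _ "(*)"] monom_eval_cong) (auto simp: vars_def)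

lemma monom_eval_Var: "monom_eval Var m = Poly_Mapping.single m (1::'r::comm_ring_1)"
proof -
  have pow: "Var v ^ n = (Poly_Mapping.single (Poly_Mapping.single v n) 1 :: ('a, 'r) mpoly)"
    for v n
    by (induction n) (simp_all add: Var_def mult_single single_add[symmetric])
  have "(\<Prod>v\<in>A. Poly_Mapping.single (Poly_Mapping.single v (f v)) 1) =
      (Poly_Mapping.single (\<Sum>v\<in>A. Poly_Mapping.single v (f v)) 1 :: ('a, 'r) mpoly)" for A f
    by (induction A rule: infinite_finite_induct) (simp_all add: mult_single)
  then show ?thesis
    unfolding monom_eval_def pow using poly_mapping_sum_monomials[of m] by simp
qed

lemma subst_Var_id [simp]: "subst Var p = p"
proof -
  have "subst Var p = (\<Sum>m\<in>Poly_Mapping.keys p. Poly_Mapping.single m (Poly_Mapping.lookup p m))"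
    unfolding subst_def monom_eval_def[symmetric] monom_eval_Var
    by (simp add: Coeff_def mult_single)
  then show ?thesis
    using poly_mapping_sum_monomials[of p] by simp
qed

lemma vars_0 [simp]: "vars 0 = {}"
  by (simp add: vars_def)

lemma vars_add: "vars p \<subseteq> A \<Longrightarrow> vars q \<subseteq> A \<Longrightarrow> vars (p + q) \<subseteq> A"
  unfolding vars_def using Poly_Mapping.keys_add[of p q] by blast

lemma vars_sum: "(\<And>i. i \<in> I \<Longrightarrow> vars (f i) \<subseteq> A) \<Longrightarrow> vars (\<Sum>i\<in>I. f i) \<subseteq> A"
  by (induction I rule: infinite_finite_induct) (simp_all add: vars_add)

lemma keys_add_nat: "Poly_Mapping.keys (m + m' :: 'v \<Rightarrow>\<^sub>0 nat) = Poly_Mapping.keys m \<union> Poly_Mapping.keys m'"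
  by (auto simp: in_keys_iff lookup_add)

lemma vars_mult:
  assumes "vars p \<subseteq> A" "vars q \<subseteq> A" shows "vars (p * q) \<subseteq> A"
proof
  fix v assume "v \<in> vars (p * q)"
  then obtain m where m: "m \<in> Poly_Mapping.keys (p * q)" "v \<in> Poly_Mapping.keys m"
    by (auto simp: vars_def)
  then obtain a b where "m = a + b" "a \<in> Poly_Mapping.keys p" "b \<in> Poly_Mapping.keys q"
    using Poly_Mapping.keys_mult[of p q] by blast
  with m assms show "v \<in> A" by (auto simp: vars_def keys_add_nat)
qed

lemma vars_uminus [simp]: "vars (- p) = vars (p :: ('v, 'r::ab_group_add) mpoly)"
  by (simp add: vars_def keys_def)

lemma vars_diff: "vars p \<subseteq> A \<Longrightarrow> vars q \<subseteq> A \<Longrightarrow> vars (p - q :: ('v, 'r::ab_group_add) mpoly) \<subseteq> A"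
  using vars_add[of p A "- q"] by simp

lemma vars_Coeff [simp]: "vars (Coeff c) = {}"
  by (auto simp: vars_def Coeff_def)

lemma vars_1 [simp]: "vars (1 :: ('v, 'r::comm_ring_1) mpoly) = {}"
  using vars_Coeff[of "1::'r", where ?'a = 'v] by simp

lemma vars_Var [simp]: "vars (Var v :: ('v, 'r::comm_ring_1) mpoly) = {v}"
  by (simp add: vars_def Var_def)

text \<open>A substitution only forms finite sums and products of constants and values
  \<open>s v\<close>. With \<open>s = Var\<close> this becomes structural induction on polynomials;
  it also gives the closure of symmetric polynomials under substitution.\<close>

lemma subst_in_closed:
  fixes p :: "('v, 'r::comm_ring_1) mpoly"
  assumes "\<And>c. P (Coeff c)" "\<And>p q. P p \<Longrightarrow> P q \<Longrightarrow> P (p + q)" "\<And>p q. P p \<Longrightarrow> P q \<Longrightarrow> P (p * q)"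
    and "\<And>v. v \<in> vars p \<Longrightarrow> P (s v)"
  shows "P (subst s p)"
proof -
  have sum: "P (\<Sum>i\<in>I. f i)" if "\<And>i. i \<in> I \<Longrightarrow> P (f i)" for f and I :: "('v \<Rightarrow>\<^sub>0 nat) set"
    using that assms(1)[of 0] by (induction I rule: infinite_finite_induct) (auto intro: assms(2))
  have pow: "P (x ^ n)" if "P x" for x and n :: nat
    using that assms(1)[of 1] by (induction n) (auto intro: assms(3))
  have prod: "P (\<Prod>i\<in>I. f i)" if "\<And>i. i \<in> I \<Longrightarrow> P (f i)" for f and I :: "'v set"
    using that assms(1)[of 1] by (induction I rule: infinite_finite_induct) (auto intro: assms(3))
  show ?thesis
    unfolding subst_def
    by (rule sum, rule assms(3), rule assms(1), rule prod, rule pow, rule assms(4)) (auto simp: vars_def)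
qed

section \<open>Total degree of monomials and polynomials\<close>

definition deg :: "('v \<Rightarrow>\<^sub>0 nat) \<Rightarrow> nat" where
  "deg m = (\<Sum>i\<in>Poly_Mapping.keys m. Poly_Mapping.lookup m i)"

lemma deg_superset:
  assumes "finite A" "Poly_Mapping.keys m \<subseteq> A"
  shows "deg m = (\<Sum>v\<in>A. Poly_Mapping.lookup m v)"
  unfolding deg_def
  by (rule sum.mono_neutral_left) (use assms in \<open>auto simp: in_keys_iff\<close>)

lemma deg_0 [simp]: "deg 0 = 0"
  by (simp add: deg_def)

lemma deg_add: "deg (m + m') = deg m + deg m'"
proof -
  let ?A = "Poly_Mapping.keys m \<union> Poly_Mapping.keys m'"
  have "deg (m + m') = (\<Sum>v\<in>?A. Poly_Mapping.lookup (m + m') v)"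
    by (rule deg_superset) (simp_all add: Poly_Mapping.keys_add)
  then show ?thesis
    using deg_superset[of ?A m] deg_superset[of ?A m'] by (simp add: lookup_add sum.distrib)
qed

lemma deg_single [simp]: "deg (Poly_Mapping.single v n) = n"
  by (cases "n = 0") (simp_all add: deg_def)

lemma lookup_le_deg: "Poly_Mapping.lookup m v \<le> deg m"
  unfolding deg_def by (cases "v \<in> Poly_Mapping.keys m") (auto simp: member_le_sum in_keys_iff)

definition deg_le :: "nat \<Rightarrow> ('v, 'r::zero) mpoly \<Rightarrow> bool" where
  "deg_le d p \<longleftrightarrow> (\<forall>m\<in>Poly_Mapping.keys p. deg m \<le> d)"

lemma deg_le_mono: "deg_le d p \<Longrightarrow> d \<le> d' \<Longrightarrow> deg_le d' p"
  by (auto simp: deg_le_def)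

lemma deg_le_add: "deg_le d p \<Longrightarrow> deg_le d q \<Longrightarrow> deg_le d (p + q)"
  unfolding deg_le_def using Poly_Mapping.keys_add[of p q] by blast

lemma deg_le_mult:
  assumes "deg_le d p" "deg_le d' q" shows "deg_le (d + d') (p * q)"
  unfolding deg_le_def
proof
  fix m assume "m \<in> Poly_Mapping.keys (p * q)"
  then obtain a b where "m = a + b" "a \<in> Poly_Mapping.keys p" "b \<in> Poly_Mapping.keys q"
    using Poly_Mapping.keys_mult[of p q] by blast
  with assms show "deg m \<le> d + d'" by (auto simp: deg_le_def deg_add add_mono)
qed

lemma deg_le_Coeff [simp]: "deg_le d (Coeff c)"
  by (auto simp: deg_le_def Coeff_def)

lemma deg_le_0 [simp]: "deg_le d 0"
  by (simp add: deg_le_def)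

lemma deg_le_1 [simp]: "deg_le d (1 :: ('v, 'r::comm_ring_1) mpoly)"
  using deg_le_Coeff[of d "1::'r", where ?'a = 'v] by simp

lemma deg_le_Var_minus_Coeff: "deg_le 1 (Var v - Coeff c)"
proof -
  have "deg_le 1 (Var v + Coeff (- c))"
    by (rule deg_le_add) (simp_all add: deg_le_def Var_def Coeff_def)
  then show ?thesis by (simp add: Coeff_uminus)
qed

subsection \<open>Leading monomials\<close>

text \<open>Since only the variables with positive index occur in monomials, recording the total
  degree at index \<open>0\<close> turns the lexicographic order of the library into the graded one.\<close>

definition grlex :: "(nat \<Rightarrow>\<^sub>0 nat) \<Rightarrow> (nat \<Rightarrow>\<^sub>0 nat)" where
  "grlex m = Poly_Mapping.single 0 (deg m) + m"

lemma grlex_add: "grlex (m + m') = grlex m + grlex m'"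
  by (simp add: grlex_def deg_add single_add add_ac)

lemma grlex_0 [simp]: "grlex 0 = 0"
  by (simp add: grlex_def)

text \<open>The entry at \<open>0\<close> is \<open>deg m\<close> + m_0, that is 2 m_0 plus the
  positive-index exponents. The latter are read off from the other entries, so m_0 is determined as
  well.\<close>

lemma grlex_inject:
  assumes "grlex m = grlex m'" shows "m = m'"
proof -
  have eq: "Poly_Mapping.lookup (grlex m) i = Poly_Mapping.lookup (grlex m') i" for i
    using assms by simp
  have pos: "Poly_Mapping.lookup m i = Poly_Mapping.lookup m' i" if "i \<noteq> 0" for i
    using eq[of i] that by (simp add: grlex_def lookup_add lookup_single)
  let ?A = "insert 0 (Poly_Mapping.keys m \<union> Poly_Mapping.keys m')"
  have "(\<Sum>v\<in>?A - {0}. Poly_Mapping.lookup m v) = (\<Sum>v\<in>?A - {0}. Poly_Mapping.lookup m' v)"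
    by (rule sum.cong) (auto simp: pos)
  moreover have "deg m = Poly_Mapping.lookup m 0 + (\<Sum>v\<in>?A - {0}. Poly_Mapping.lookup m v)"
    by (subst deg_superset[of ?A]) (auto simp: sum.remove[of ?A 0] simp del: sum.insert_remove)
  moreover have "deg m' = Poly_Mapping.lookup m' 0 + (\<Sum>v\<in>?A - {0}. Poly_Mapping.lookup m' v)"
    by (subst deg_superset[of ?A]) (auto simp: sum.remove[of ?A 0] simp del: sum.insert_remove)
  ultimately have "Poly_Mapping.lookup m 0 = Poly_Mapping.lookup m' 0"
    using eq[of 0] by (simp add: grlex_def lookup_add)
  with pos show ?thesis by (metis poly_mapping_eqI)
qed

text \<open>Under these assumptions the entry at \<open>0\<close> is the degree itself. The first
  difference is either there, with the smaller degree on the left, or later, with equal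
  degrees.\<close>

lemma grlex_less_imp_deg_le:
  assumes "grlex m < grlex m'" "0 \<notin> Poly_Mapping.keys m" "0 \<notin> Poly_Mapping.keys m'"
  shows "deg m \<le> deg m'"
proof -
  have z: "Poly_Mapping.lookup (grlex m) 0 = deg m" "Poly_Mapping.lookup (grlex m') 0 = deg m'"
    using assms by (auto simp: grlex_def lookup_add in_keys_iff)
  obtain k where "Poly_Mapping.lookup (grlex m) k < Poly_Mapping.lookup (grlex m') k"
    "\<forall>j<k. Poly_Mapping.lookup (grlex m) j = Poly_Mapping.lookup (grlex m') j"
    using assms(1) by (auto simp: less_poly_mapping.rep_eq less_fun_def)
  then show ?thesis using z by (cases "k = 0") auto
qed

lemma grlex_lessI:
  assumes "deg m = deg m'" "Poly_Mapping.lookup m i < Poly_Mapping.lookup m' i"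
    "\<And>j. j < i \<Longrightarrow> Poly_Mapping.lookup m j = Poly_Mapping.lookup m' j"
  shows "grlex m < grlex m'"
  unfolding less_poly_mapping.rep_eq less_fun_def
  using assms by (intro exI[of _ i]) (auto simp: grlex_def lookup_add)

definition low :: "(nat \<Rightarrow>\<^sub>0 nat) \<Rightarrow> (nat, 'r::comm_ring_1) mpoly \<Rightarrow> bool" where
  "low m p \<longleftrightarrow> (\<forall>k\<in>Poly_Mapping.keys p. grlex k < grlex m)"

text \<open>The leading monomial is \<open>m\<close>, with coefficient 1. Asking for 1 makes the
  property multiplicative over every commutative ring and lets a leading term be cancelled without
  division.\<close>

definition monic_at :: "(nat \<Rightarrow>\<^sub>0 nat) \<Rightarrow> (nat, 'r::comm_ring_1) mpoly \<Rightarrow> bool" where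
  "monic_at m p \<longleftrightarrow> low m (p - Poly_Mapping.single m 1)"

lemma low_0 [simp]: "low m 0"
  by (simp add: low_def)

lemma low_add: "low m p \<Longrightarrow> low m q \<Longrightarrow> low m (p + q)"
  unfolding low_def using Poly_Mapping.keys_add[of p q] by blast

lemma lookup_low: "low m p \<Longrightarrow> Poly_Mapping.lookup p m = 0"
  by (auto simp: low_def in_keys_iff)

lemma low_mult_leq:
  assumes "low m p" "\<And>k. k \<in> Poly_Mapping.keys q \<Longrightarrow> grlex k \<le> grlex m'"
  shows "low (m + m') (p * q)"
  unfolding low_def
proof
  fix k assume "k \<in> Poly_Mapping.keys (p * q)"
  then obtain a b where "k = a + b" "a \<in> Poly_Mapping.keys p" "b \<in> Poly_Mapping.keys q"
    using Poly_Mapping.keys_mult[of p q] by blast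
  with assms show "grlex k < grlex (m + m')"
    by (auto simp: low_def grlex_add intro: add_less_le_mono)
qed

lemma monic_at_keys:
  assumes "monic_at m p" "k \<in> Poly_Mapping.keys p" shows "k = m \<or> grlex k < grlex m"
proof -
  have "k \<in> Poly_Mapping.keys (p - Poly_Mapping.single m 1)" if "k \<noteq> m"
    using that assms(2) by (simp add: in_keys_iff lookup_minus lookup_single)
  with assms(1) show ?thesis by (auto simp: monic_at_def low_def)
qed

lemma lookup_monic_at: "monic_at m p \<Longrightarrow> Poly_Mapping.lookup p m = 1"
  using lookup_low[of m "p - Poly_Mapping.single m 1"] by (simp add: monic_at_def lookup_minus)

lemma monic_at_imp_low: "monic_at m p \<Longrightarrow> grlex m < grlex m' \<Longrightarrow> low m' p"
  unfolding low_def by (metis monic_at_keys order_less_trans)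

lemma monic_at_add_low: "monic_at m p \<Longrightarrow> low m q \<Longrightarrow> monic_at m (p + q)"
  unfolding monic_at_def by (metis low_add add.commute add_diff_eq)

lemma monic_at_mult:
  assumes "monic_at m p" "monic_at m' q" shows "monic_at (m + m') (p * q)"
proof -
  let ?a = "Poly_Mapping.single m 1" and ?b = "Poly_Mapping.single m' 1"
  have "low (m + m') ((p - ?a) * q)"
    using assms by (intro low_mult_leq) (auto simp: monic_at_def dest: monic_at_keys[OF assms(2)])
  moreover have "low (m' + m) ((q - ?b) * ?a)"
    using assms by (intro low_mult_leq) (auto simp: monic_at_def split: if_splits)
  ultimately have "low (m + m') ((p - ?a) * q + (q - ?b) * ?a)"
    by (simp add: low_add add.commute)
  moreover have "(p - ?a) * q + (q - ?b) * ?a = p * q - ?a * ?b"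
    by (simp add: algebra_simps)
  ultimately show ?thesis by (simp add: monic_at_def mult_single)
qed

lemma monic_at_1: "monic_at 0 1"
  by (simp add: monic_at_def)

lemma monic_at_prod:
  "(\<And>i. i \<in> I \<Longrightarrow> monic_at (M i) (p i)) \<Longrightarrow> monic_at (\<Sum>i\<in>I. M i) (\<Prod>i\<in>I. p i)"
  by (induction I rule: infinite_finite_induct) (simp_all add: monic_at_mult monic_at_1)

lemma monic_at_Var_minus_Coeff: "i \<noteq> 0 \<Longrightarrow> monic_at (Poly_Mapping.single i 1) (Var i - Coeff c)"
proof -
  assume "i \<noteq> 0"
  have "Var i - Coeff c - Poly_Mapping.single (Poly_Mapping.single i 1) 1 = Coeff (- c)"
    by (simp add: Var_def Coeff_uminus)
  moreover have "0 < grlex (Poly_Mapping.single i 1)"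
    unfolding less_poly_mapping.rep_eq less_fun_def
    by (rule exI[of _ 0]) (auto simp: grlex_def lookup_add)
  ultimately show ?thesis by (auto simp: monic_at_def low_def Coeff_def)
qed

subsection \<open>Recurrences for the double elementary and complete functions\<close>

lemma vars_prod: "(\<And>i. i \<in> I \<Longrightarrow> vars (f i) \<subseteq> A) \<Longrightarrow> vars (\<Prod>i\<in>I. f i :: ('v, 'r::comm_ring_1) mpoly) \<subseteq> A"
  by (induction I rule: infinite_finite_induct) (simp_all add: vars_mult)

lemma deg_le_sum: "(\<And>i. i \<in> I \<Longrightarrow> deg_le d (f i)) \<Longrightarrow> deg_le d (\<Sum>i\<in>I. f i)"
  by (induction I rule: infinite_finite_induct) (simp_all add: deg_le_add)

lemma deg_le_prod_lessThan:
  "(\<And>j. j < k \<Longrightarrow> deg_le 1 (f j)) \<Longrightarrow> deg_le k (\<Prod>j<k. f j :: ('v, 'r::comm_ring_1) mpoly)"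
proof (induction k)
  case (Suc k)
  then have "deg_le (k + 1) ((\<Prod>j<k. f j) * f k)" by (intro deg_le_mult) auto
  then show ?case by simp
qed simp

abbreviation (input) shift :: "(int \<Rightarrow> 'r) \<Rightarrow> int \<Rightarrow> 'r" where
  "shift b \<equiv> \<lambda>i. b (i + 1)"

abbreviation (input) unshift :: "(int \<Rightarrow> 'r) \<Rightarrow> int \<Rightarrow> 'r" where
  "unshift b \<equiv> \<lambda>i. b (i - 1)"

lemma finite_index_lists: "finite {is. length is = k \<and> set is \<subseteq> {1..n::nat} \<and> sorted_wrt R is}"
  by (rule finite_subset[OF _ finite_lists_length_eq[of "{1..n}" k]]) auto

lemma double_e_0 [simp]: "double_e 0 b n = 1"
proof -
  have "{is. length is = 0 \<and> set is \<subseteq> {1..n} \<and> sorted_wrt (>) is} = {[]}" by auto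
  then show ?thesis by (simp add: double_e_def)
qed

lemma double_h_0 [simp]: "double_h 0 b n = 1"
proof -
  have "{is. length is = 0 \<and> set is \<subseteq> {1..n} \<and> sorted_wrt (\<ge>) is} = {[]}" by auto
  then show ?thesis by (simp add: double_h_def)
qed

lemma double_e_Suc_0 [simp]: "double_e (Suc k) b 0 = 0"
proof -
  have "{is. length is = Suc k \<and> set is \<subseteq> {1..0::nat} \<and> sorted_wrt (>) is} = {}" by (auto simp: length_Suc_conv)
  then show ?thesis unfolding double_e_def by (simp only: sum.empty)
qed

lemma double_h_Suc_0 [simp]: "double_h (Suc k) b 0 = 0"
proof -
  have "{is. length is = Suc k \<and> set is \<subseteq> {1..0::nat} \<and> sorted_wrt (\<ge>) is} = {}" by (auto simp: length_Suc_conv)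
  then show ?thesis unfolding double_h_def by (simp only: sum.empty)
qed

text \<open>The lists are split by whether i_1 = n+1. Deleting that entry moves the others one
  position forward, for which the shift of \<open>b\<close> compensates; strict decrease leaves them
  at most \<open>n\<close>.\<close>

lemma double_e_Suc:
  "double_e (Suc k) b (Suc n) = double_e (Suc k) b n +
     (Var (Suc n) - Coeff (b (int (Suc n)))) * double_e k (shift b) n"
proof -
  let ?S = "\<lambda>k n. {is. length is = k \<and> set is \<subseteq> {1..n} \<and> sorted_wrt (>) is}"
  let ?f = "\<lambda>b k is. \<Prod>j<k. Var (is ! j) - Coeff (b (int (is ! j) + int j)) :: xpoly"
  have eq: "?S (Suc k) (Suc n) = ?S (Suc k) n \<union> (#) (Suc n) ` ?S k n"
  proof (rule set_eqI)
    fix xs show "xs \<in> ?S (Suc k) (Suc n) \<longleftrightarrow> xs \<in> ?S (Suc k) n \<union> (#) (Suc n) ` ?S k n"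
    proof (cases xs)
      case (Cons y ys)
      have "xs \<in> ?S (Suc k) (Suc n) \<longleftrightarrow>
         length ys = k \<and> 1 \<le> y \<and> y \<le> Suc n \<and> (\<forall>z\<in>set ys. 1 \<le> z \<and> z < y) \<and> sorted_wrt (>) ys"
        by (auto simp: Cons)
      moreover have "xs \<in> ?S (Suc k) n \<longleftrightarrow>
         length ys = k \<and> 1 \<le> y \<and> y \<le> n \<and> (\<forall>z\<in>set ys. 1 \<le> z \<and> z < y) \<and> sorted_wrt (>) ys"
        by (auto simp: Cons)
      moreover have "xs \<in> (#) (Suc n) ` ?S k n \<longleftrightarrow>
         y = Suc n \<and> length ys = k \<and> (\<forall>z\<in>set ys. 1 \<le> z \<and> z < y) \<and> sorted_wrt (>) ys"
        by (auto simp: Cons less_Suc_eq_le)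
      ultimately show ?thesis by (auto simp: le_Suc_eq)
    qed auto
  qed
  have "double_e (Suc k) b (Suc n) = sum (?f b (Suc k)) (?S (Suc k) n) + sum (?f b (Suc k)) ((#) (Suc n) ` ?S k n)"
    unfolding double_e_def eq
    by (rule sum.union_disjoint, rule finite_index_lists, rule finite_imageI, rule finite_index_lists) auto
  also have "sum (?f b (Suc k)) ((#) (Suc n) ` ?S k n) = (\<Sum>is\<in>?S k n. ?f b (Suc k) (Suc n # is))"
    by (subst sum.reindex) (auto simp: inj_on_def)
  also have "\<dots> = (Var (Suc n) - Coeff (b (int (Suc n)))) * double_e k (shift b) n"
    unfolding double_e_def sum_distrib_left
    by (intro sum.cong refl, subst prod.lessThan_Suc_shift) (simp add: algebra_simps)
  finally show ?thesis by (simp add: double_e_def)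
qed

text \<open>As for \<open>double_e_Suc\<close>, except that n+1 may be repeated: the shorter
  function keeps n+1 variables, so this recurrence cannot be unrolled by induction on
  \<open>n\<close> alone.\<close>

lemma double_h_Suc:
  "double_h (Suc k) b (Suc n) = double_h (Suc k) b n +
     (Var (Suc n) - Coeff (b (int (Suc n)))) * double_h k (unshift b) (Suc n)"
proof -
  let ?S = "\<lambda>k n. {is. length is = k \<and> set is \<subseteq> {1..n} \<and> sorted_wrt (\<ge>) is}"
  let ?f = "\<lambda>b k is. \<Prod>j<k. Var (is ! j) - Coeff (b (int (is ! j) - int j)) :: xpoly"
  have eq: "?S (Suc k) (Suc n) = ?S (Suc k) n \<union> (#) (Suc n) ` ?S k (Suc n)"
  proof (rule set_eqI)
    fix xs show "xs \<in> ?S (Suc k) (Suc n) \<longleftrightarrow> xs \<in> ?S (Suc k) n \<union> (#) (Suc n) ` ?S k (Suc n)"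
    proof (cases xs)
      case (Cons y ys)
      have "xs \<in> ?S (Suc k) (Suc n) \<longleftrightarrow>
         length ys = k \<and> 1 \<le> y \<and> y \<le> Suc n \<and> (\<forall>z\<in>set ys. 1 \<le> z \<and> z \<le> y) \<and> sorted_wrt (\<ge>) ys"
        by (auto simp: Cons)
      moreover have "xs \<in> ?S (Suc k) n \<longleftrightarrow>
         length ys = k \<and> 1 \<le> y \<and> y \<le> n \<and> (\<forall>z\<in>set ys. 1 \<le> z \<and> z \<le> y) \<and> sorted_wrt (\<ge>) ys"
        by (auto simp: Cons)
      moreover have "xs \<in> (#) (Suc n) ` ?S k (Suc n) \<longleftrightarrow>
         y = Suc n \<and> length ys = k \<and> (\<forall>z\<in>set ys. 1 \<le> z \<and> z \<le> y) \<and> sorted_wrt (\<ge>) ys"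
        by (auto simp: Cons)
      ultimately show ?thesis by (auto simp: le_Suc_eq)
    qed auto
  qed
  have "double_h (Suc k) b (Suc n) = sum (?f b (Suc k)) (?S (Suc k) n) + sum (?f b (Suc k)) ((#) (Suc n) ` ?S k (Suc n))"
    unfolding double_h_def eq
    by (rule sum.union_disjoint, rule finite_index_lists, rule finite_imageI, rule finite_index_lists) auto
  also have "sum (?f b (Suc k)) ((#) (Suc n) ` ?S k (Suc n)) = (\<Sum>is\<in>?S k (Suc n). ?f b (Suc k) (Suc n # is))"
    by (subst sum.reindex) (auto simp: inj_on_def)
  also have "\<dots> = (Var (Suc n) - Coeff (b (int (Suc n)))) * double_h k (unshift b) (Suc n)"
    unfolding double_h_def sum_distrib_left
    by (intro sum.cong refl, subst prod.lessThan_Suc_shift) (simp add: algebra_simps)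
  finally show ?thesis by (simp add: double_h_def)
qed

lemma index_list_nth: "is \<in> {is. length is = k \<and> set is \<subseteq> {1..n::nat} \<and> sorted_wrt R is} \<Longrightarrow> j < k \<Longrightarrow> is ! j \<in> {1..n}"
  using nth_mem by blast

lemma vars_double_e: "vars (double_e k b n) \<subseteq> {1..n}"
  unfolding double_e_def
  by (intro vars_sum vars_prod vars_diff) (use index_list_nth in auto)

lemma vars_double_h: "vars (double_h k b n) \<subseteq> {1..n}"
  unfolding double_h_def
  by (intro vars_sum vars_prod vars_diff) (use index_list_nth in auto)

lemma deg_le_double_e: "deg_le k (double_e k b n)"
  unfolding double_e_def
  by (intro deg_le_sum deg_le_prod_lessThan deg_le_Var_minus_Coeff)

lemma deg_le_double_h: "deg_le k (double_h k b n)"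
  unfolding double_h_def
  by (intro deg_le_sum deg_le_prod_lessThan deg_le_Var_minus_Coeff)

lemma subst_upd_unused: "n \<notin> vars p \<Longrightarrow> subst (Var(n := q)) p = p"
  using subst_cong[of p "Var(n := q)" Var] by (metis fun_upd_other subst_Var_id)

text \<open>The factor x_{n+1} - b_{n+1} vanishes: an entry n+1 can only stand at position 0, where
  the index of \<open>b\<close> is not shifted.\<close>

lemma double_e_stable:
  "subst (Var(Suc n := Coeff (b (int (Suc n))))) (double_e k b (Suc n)) = double_e k b n"
proof (cases k)
  case (Suc k')
  have "Suc n \<notin> vars (double_e k b n)" using vars_double_e[of k b n] by auto
  then show ?thesis using Suc by (simp add: double_e_Suc subst_add subst_mult subst_diff subst_upd_unused del: of_nat_Suc)
qed simp

lemma double_h_stable: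
  "subst (Var(Suc n := Coeff (b (int (Suc n))))) (double_h k b (Suc n)) = double_h k b n"
proof (cases k)
  case (Suc k')
  have "Suc n \<notin> vars (double_h k b n)" using vars_double_h[of k b n] by auto
  then show ?thesis using Suc by (simp add: double_h_Suc subst_add subst_mult subst_diff subst_upd_unused del: of_nat_Suc)
qed simp

subsection \<open>Generating series\<close>

definition lin :: "'r::comm_ring_1 \<Rightarrow> 'r fps" where
  "lin c = 1 + fps_const c * fps_X"

definition geo :: "'r::comm_ring_1 \<Rightarrow> 'r fps" where
  "geo c = Abs_fps (\<lambda>n. c ^ n)"

lemma lin_geo: "lin (- c) * geo c = 1"
proof (rule fps_ext)
  fix n show "(lin (- c) * geo c) $ n = 1 $ n"
    by (cases n) (simp_all add: lin_def geo_def distrib_right mult.assoc fps_X_mult_nth)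
qed

lemma lin_geo': "lin c * geo (- c) = 1"
  using lin_geo[of "- c"] by simp

definition gen_e :: "(int \<Rightarrow> qa) \<Rightarrow> nat \<Rightarrow> xpoly fps" where
  "gen_e b n = (\<Prod>i=1..n. lin (Var i) * geo (- Coeff (b (int i))))"

definition gen_h :: "(int \<Rightarrow> qa) \<Rightarrow> nat \<Rightarrow> xpoly fps" where
  "gen_h b n = (\<Prod>i=1..n. lin (- Coeff (b (int i))) * geo (Var i))"

text \<open>Expansions are taken along the series \<open>dfac b k\<close>, i.e.
  $t^k / ((1 + b_1 t) \cdots (1 + b_k t))$.\<close>

definition dfac :: "(int \<Rightarrow> qa) \<Rightarrow> nat \<Rightarrow> xpoly fps" where
  "dfac b k = fps_X ^ k * (\<Prod>j<k. geo (- Coeff (b (int j + 1))))"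

lemma dfac_Suc: "dfac b (Suc k) = fps_X * geo (- Coeff (b 1)) * dfac (shift b) k"
  unfolding dfac_def by (subst prod.lessThan_Suc_shift) (simp add: mult_ac add_ac)

lemma dfac_nth_less: "m < k \<Longrightarrow> dfac b k $ m = 0"
  by (simp add: dfac_def fps_X_power_mult_nth)

lemma dfac_nth_self: "dfac b k $ k = 1"
proof -
  have "(\<Prod>j<k. f j) $ 0 = (\<Prod>j<k. f j $ 0)" for f :: "nat \<Rightarrow> xpoly fps"
    by (induction k) simp_all
  then show ?thesis by (simp add: dfac_def fps_X_power_mult_nth geo_def)
qed

text \<open>This makes the expansion coefficients scalars for every Q[a]-linear map on sequences:
  they involve neither the x_i nor the number of variables.\<close>

lemma dfac_nth_Coeff: "\<exists>c. dfac b k $ m = Coeff c"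
proof (induction k arbitrary: b m)
  case 0
  have "(1 :: xpoly fps) $ m = Coeff (if m = 0 then 1 else 0)" by simp
  moreover have "dfac b 0 = 1" by (simp add: dfac_def)
  ultimately show ?case by (metis (no_types))
next
  case (Suc k)
  have "\<exists>c. (geo (- Coeff (b 1)) * dfac (shift b) k) $ m = Coeff c" for m
  proof -
    have "\<forall>m. \<exists>c. dfac (shift b) k $ m = Coeff c" by (intro allI Suc)
    from choice[OF this] obtain c where c: "\<And>m. dfac (shift b) k $ m = Coeff (c m)" by blast
    have "(geo (- Coeff (b 1)) * dfac (shift b) k) $ m = Coeff (\<Sum>i=0..m. (- b 1) ^ i * c (m - i))"
      by (simp add: fps_mult_nth geo_def c Coeff_sum Coeff_mult Coeff_power Coeff_uminus)
    then show ?thesis ..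
  qed
  then show ?case
    unfolding dfac_Suc mult.assoc fps_X_mult_nth by (cases "m = 0") (simp_all add: exI[of _ 0])
qed

text \<open>The infinite sum of all \<open>a k * dfac b k\<close>. It can be cut off at k \<le> m in
  degree m because \<open>dfac b k\<close> starts at t^k.\<close>

definition dseries :: "(nat \<Rightarrow> xpoly) \<Rightarrow> (int \<Rightarrow> qa) \<Rightarrow> xpoly fps" where
  "dseries a b = Abs_fps (\<lambda>m. \<Sum>k\<le>m. a k * dfac b k $ m)"

lemma dseries_unit: "dseries (\<lambda>k. if k = 0 then 1 else 0) b = 1"
proof (rule fps_ext)
  fix m
  have "(\<Sum>k\<le>m. (if k = 0 then 1 else 0) * dfac b k $ m) = (\<Sum>k\<le>m. if k = 0 then dfac b k $ m else 0)"
    by (rule sum.cong) auto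
  then show "dseries (\<lambda>k. if k = 0 then 1 else 0) b $ m = 1 $ m"
    by (simp add: dseries_def dfac_def)
qed

text \<open>Since \<open>dfac b (Suc k)\<close> is t / (1 + b_1 t) times
  \<open>dfac (shift b) k\<close>, a recurrence between coefficients becomes an equation between
  series, with \<open>b\<close> shifted in the last term.\<close>

lemma dseries_rec:
  assumes "a 0 = a' 0" "\<And>k. a (Suc k) = a' (Suc k) + c * a'' k"
  shows "dseries a b = dseries a' b + fps_const c * fps_X * geo (- Coeff (b 1)) * dseries a'' (shift b)"
proof (rule fps_ext)
  fix m
  let ?g = "geo (- Coeff (b 1))"
  show "dseries a b $ m = (dseries a' b + fps_const c * fps_X * ?g * dseries a'' (shift b)) $ m"
  proof (cases m)
    case 0
    then show ?thesis using assms by (simp add: dseries_def mult.assoc)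
  next
    case (Suc l)
    have "(?g * dseries a'' (shift b)) $ l =
        (\<Sum>i=0..l. ?g $ i * (\<Sum>k\<le>l - i. a'' k * dfac (shift b) k $ (l - i)))"
      by (simp add: fps_mult_nth dseries_def)
    \<comment> \<open>The added terms, with k > l - i, are zero. The inner range is now independent
      of \<open>i\<close>, so the sums can be exchanged.\<close>
    also have "\<dots> = (\<Sum>i=0..l. ?g $ i * (\<Sum>k\<le>l. a'' k * dfac (shift b) k $ (l - i)))"
      by (intro sum.cong refl arg_cong2[of _ _ _ _ "(*)"] sum.mono_neutral_left)
         (auto simp: dfac_nth_less)
    also have "\<dots> = (\<Sum>k\<le>l. \<Sum>i=0..l. a'' k * (?g $ i * dfac (shift b) k $ (l - i)))"
      by (subst sum.swap) (simp add: sum_distrib_left mult_ac)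
    also have "\<dots> = (\<Sum>k\<le>l. a'' k * dfac b (Suc k) $ Suc l)"
      by (simp add: dfac_Suc mult.assoc fps_X_mult_nth fps_mult_nth[of ?g] sum_distrib_left del: fps_mult_nth_0)
    finally have *: "(?g * dseries a'' (shift b)) $ l = (\<Sum>k\<le>l. a'' k * dfac b (Suc k) $ Suc l)" .
    have "(dseries a b - dseries a' b) $ m = (\<Sum>k\<le>l. c * (a'' k * dfac b (Suc k) $ Suc l))"
      unfolding Suc by (simp add: dseries_def sum.atMost_Suc_shift assms sum.distrib algebra_simps
          del: sum.atMost_Suc)
    also have "\<dots> = (fps_const c * fps_X * ?g * dseries a'' (shift b)) $ m"
      by (simp add: Suc mult.assoc * sum_distrib_left)
    finally show ?thesis by (simp add: algebra_simps)
  qed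
qed

lemma gen_e_Suc: "gen_e b (Suc n) = gen_e b n * (lin (Var (Suc n)) * geo (- Coeff (b (int (Suc n)))))"
  by (simp add: gen_e_def)

lemma gen_h_Suc: "gen_h b (Suc n) = gen_h b n * (lin (- Coeff (b (int (Suc n)))) * geo (Var (Suc n)))"
  by (simp add: gen_h_def)

text \<open>Both sides are the product of the 1 + x_i t divided by (1 + b_1 t) ... (1 + b_{n+1} t),
  grouped differently.\<close>

lemma gen_e_shift:
  "geo (- Coeff (b 1)) * gen_e (shift b) n = gen_e b n * geo (- Coeff (b (int (Suc n))))"
proof (induction n)
  case 0
  then show ?case by (simp add: gen_e_def)
next
  case (Suc n)
  have i: "int (Suc n) + 1 = int (Suc (Suc n))" by simp
  let ?y = "lin (Var (Suc n)) * geo (- Coeff (b (int (Suc (Suc n)))))"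
  have "geo (- Coeff (b 1)) * gen_e (shift b) (Suc n) = (geo (- Coeff (b 1)) * gen_e (shift b) n) * ?y"
    unfolding gen_e_Suc i by (simp only: mult.assoc)
  then show ?case
    unfolding Suc gen_e_Suc by (simp only: mult_ac)
qed

text \<open>For n \<ge> 1 the numerator is (1 - b_1 t) ... (1 - b_{n-1} t) on both sides: the factor
  of index 0 cancels on the left, that of index n on the right.\<close>

lemma gen_h_unshift:
  "geo (Coeff (b 0)) * gen_h (unshift b) n = geo (Coeff (b (int n))) * gen_h b n"
proof (induction n)
  case 0
  then show ?case by (simp add: gen_h_def)
next
  case (Suc n)
  have i: "int (Suc n) - 1 = int n" by simp
  let ?G = "\<lambda>i. geo (Coeff (b i))" and ?L = "\<lambda>i. lin (- Coeff (b i))"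
  have "?G 0 * gen_h (unshift b) (Suc n) =
      (?G 0 * gen_h (unshift b) n) * (?L (int n) * geo (Var (Suc n)))"
    unfolding gen_h_Suc i by (simp only: mult.assoc)
  also have "\<dots> = (?L (int n) * ?G (int n)) * gen_h b n * geo (Var (Suc n))"
    unfolding Suc by (simp only: mult_ac)
  also have "\<dots> = (?L (int (Suc n)) * ?G (int (Suc n))) * gen_h b n * geo (Var (Suc n))"
    unfolding lin_geo ..
  finally show ?case unfolding gen_h_Suc by (simp only: mult_ac)
qed

lemma lin_add: "lin (c + d) = lin c + fps_const d * fps_X"
  by (simp add: lin_def distrib_right fps_const_add[symmetric] del: fps_const_add)

text \<open>By the recurrence and \<open>gen_e_shift\<close>, a new variable x multiplies the
  expansion by 1 + (x - b) t / (1 + b t) = (1 + x t) / (1 + b t), where b is the entry of the same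
  index.\<close>

lemma gen_e_expansion: "gen_e b n = dseries (\<lambda>k. double_e k b n) b"
proof (induction n arbitrary: b)
  case 0
  have "(\<lambda>k. double_e k b 0) = (\<lambda>k. if k = 0 then 1 else 0)"
    by (rule ext, case_tac k) simp_all
  then show ?case by (simp add: gen_e_def dseries_unit)
next
  case (Suc n)
  let ?x = "Var (Suc n) :: xpoly" and ?b = "Coeff (b (int (Suc n))) :: xpoly"
  have "dseries (\<lambda>k. double_e k b (Suc n)) b = gen_e b n +
      fps_const (?x - ?b) * fps_X * (geo (- Coeff (b 1)) * gen_e (shift b) n)"
    unfolding Suc mult.assoc[symmetric] by (rule dseries_rec) (simp_all only: double_e_0 double_e_Suc)
  also have "\<dots> = gen_e b n * (1 + fps_const (?x - ?b) * fps_X * geo (- ?b))"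
    unfolding gen_e_shift by (simp only: distrib_left mult_1_left mult_1_right mult_ac)
  also have "1 + fps_const (?x - ?b) * fps_X * geo (- ?b) = lin ?x * geo (- ?b)"
    using lin_geo'[of ?b] lin_add[of ?b "?x - ?b"] by (simp add: distrib_right)
  finally show ?case by (simp only: gen_e_Suc)
qed

lemma dual_seq_unshift: "dual_seq (unshift b) = shift (dual_seq b)"
  by (rule ext) (simp add: dual_seq_def)

lemma dual_seq_dual_seq [simp]: "dual_seq (dual_seq b) = b"
  by (rule ext) (simp add: dual_seq_def)

text \<open>With n+1 variables on both sides of the recurrence, expansion and product are compared
  through a common equation F(b) = \<open>gen_h b n\<close> + t q(b) F(\<open>unshift b\<close>).
  Its factor t determines F coefficient by coefficient, for all \<open>b\<close>
  simultaneously.\<close>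

lemma gen_h_expansion: "gen_h b n = dseries (\<lambda>k. double_h k b n) (dual_seq b)"
proof (induction n arbitrary: b)
  case 0
  have "(\<lambda>k. double_h k b 0) = (\<lambda>k. if k = 0 then 1 else 0)"
    by (rule ext, case_tac k) simp_all
  then show ?case by (simp add: gen_h_def dseries_unit)
next
  case (Suc n)
  let ?x = "Var (Suc n) :: xpoly" and ?b = "\<lambda>b. Coeff (b (int (Suc n))) :: xpoly"
  let ?S = "\<lambda>b. dseries (\<lambda>k. double_h k b (Suc n)) (dual_seq b)"
  \<comment> \<open>The denominator 1 + b'_1 t equals 1 - b_0 t, whence
    \<open>geo (Coeff (b 0))\<close>.\<close>
  let ?q = "\<lambda>b. fps_const (?x - ?b b) * geo (Coeff (b 0))"
  have S: "?S b = gen_h b n + fps_X * (?q b * ?S (unshift b))" for b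
  proof -
    have "?S b = gen_h b n + fps_const (?x - ?b b) * fps_X * geo (- Coeff (dual_seq b 1)) *
        dseries (\<lambda>k. double_h k (unshift b) (Suc n)) (shift (dual_seq b))"
      unfolding Suc by (rule dseries_rec) (simp_all only: double_h_0 double_h_Suc)
    then show ?thesis
      unfolding dual_seq_unshift by (simp add: dual_seq_def Coeff_uminus mult_ac)
  qed
  have G: "gen_h b (Suc n) = gen_h b n + fps_X * (?q b * gen_h (unshift b) (Suc n))" for b
  proof -
    have A: "lin (- ?b b) * geo ?x = 1 + fps_const (?x - ?b b) * fps_X * geo ?x"
      using lin_geo[of ?x] lin_add[of "- ?x" "?x - ?b b"] by (simp add: distrib_right)
    have "?q b * gen_h (unshift b) (Suc n) =
        fps_const (?x - ?b b) * (geo (?b b) * gen_h b (Suc n))"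
      unfolding mult.assoc[of "fps_const _"] gen_h_unshift ..
    also have "\<dots> = fps_const (?x - ?b b) * ((lin (- ?b b) * geo (?b b)) * gen_h b n * geo ?x)"
      unfolding gen_h_Suc by (simp only: mult_ac)
    finally show ?thesis
      unfolding gen_h_Suc A lin_geo by (simp only: distrib_left mult_1_left mult_1_right mult_ac)
  qed
  have "?S b $ m = gen_h b (Suc n) $ m" for b m
  proof (induction m arbitrary: b rule: less_induct)
    case (less m)
    have "(fps_X * (?q b * ?S (unshift b))) $ m = (fps_X * (?q b * gen_h (unshift b) (Suc n))) $ m"
    proof (cases m)
      case (Suc l)
      have "(?q b * ?S (unshift b)) $ l = (?q b * gen_h (unshift b) (Suc n)) $ l"
        unfolding fps_mult_nth[of "?q b"]
        by (intro sum.cong refl arg_cong2[of _ _ _ _ "(*)"] less) (simp add: Suc)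
      then show ?thesis unfolding Suc fps_X_mult_nth by simp
    qed simp
    then show ?case by (subst S, subst G) simp
  qed
  then show ?case by (simp add: fps_eq_iff)
qed

text \<open>One matrix \<open>c\<close> serves both families and all \<open>n\<close>: each expands
  along \<open>dfac b\<close>, the second because b'' = b. Its entries are the coefficients of the
  series \<open>dfac b k\<close>.\<close>

lemma gen_triangular:
  "\<exists>c. \<forall>m n. gen_e b n $ m = double_e m b n + (\<Sum>k<m. Coeff (c m k) * double_e k b n) \<and>
    gen_h (dual_seq b) n $ m = double_h m (dual_seq b) n +
      (\<Sum>k<m. Coeff (c m k) * double_h k (dual_seq b) n)"
proof -
  have "\<forall>m. \<exists>c. \<forall>k. dfac b k $ m = Coeff (c k)" by (intro allI choice dfac_nth_Coeff)
  then obtain c where "\<And>m k. dfac b k $ m = Coeff (c m k)" by (auto dest: choice)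
  moreover have "dseries a b $ m = a m + (\<Sum>k<m. dfac b k $ m * a k)" for a m
    by (simp add: dseries_def lessThan_Suc_atMost[symmetric] dfac_nth_self mult.commute
        del: lessThan_Suc_atMost)
  ultimately show ?thesis
    unfolding gen_e_expansion gen_h_expansion dual_seq_dual_seq by (intro exI[of _ c]) simp
qed

subsection \<open>Symmetric polynomials in finitely many variables\<close>

lemma mpoly_induct [case_names Coeff Var add mult]:
  fixes p :: "('v, 'r::comm_ring_1) mpoly"
  assumes "\<And>c. P (Coeff c)" "\<And>v. P (Var v)"
    "\<And>p q. P p \<Longrightarrow> P q \<Longrightarrow> P (p + q)" "\<And>p q. P p \<Longrightarrow> P q \<Longrightarrow> P (p * q)"
  shows "P p"
  using subst_in_closed[where P = P and s = Var and p = p] assms by simp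

lemma lookup_Coeff_mult: "Poly_Mapping.lookup (Coeff c * p) m = c * Poly_Mapping.lookup p m"
  unfolding Coeff_def mult_map_scale_conv_mult[symmetric]
  by (simp add: Poly_Mapping.map.rep_eq when_def)

lemma finite_vars: "finite (vars p)"
  by (simp add: vars_def)

lemma symmetric_poly_iff:
  "symmetric_poly n p \<longleftrightarrow>
     vars p \<subseteq> {1..n} \<and> (\<forall>\<pi>. \<pi> permutes {1..n} \<longrightarrow> subst (\<lambda>i. Var (\<pi> i)) p = p)"
  by (auto simp: symmetric_poly_def vars_def)

lemma symmetric_poly_Coeff [simp]: "symmetric_poly n (Coeff c)"
  by (simp add: symmetric_poly_iff)

lemma symmetric_poly_add: "symmetric_poly n p \<Longrightarrow> symmetric_poly n q \<Longrightarrow> symmetric_poly n (p + q)"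
  by (simp add: symmetric_poly_iff vars_add subst_add)

lemma symmetric_poly_mult: "symmetric_poly n p \<Longrightarrow> symmetric_poly n q \<Longrightarrow> symmetric_poly n (p * q)"
  by (simp add: symmetric_poly_iff vars_mult subst_mult)

lemma symmetric_poly_diff: "symmetric_poly n p \<Longrightarrow> symmetric_poly n q \<Longrightarrow> symmetric_poly n (p - q)"
  by (simp add: symmetric_poly_iff vars_diff subst_diff)

lemma symmetric_poly_subst:
  "(\<And>v. v \<in> vars p \<Longrightarrow> symmetric_poly n (s v)) \<Longrightarrow> symmetric_poly n (subst s p)"
  by (rule subst_in_closed[where P = "symmetric_poly n"])
     (simp_all add: symmetric_poly_add symmetric_poly_mult)

section \<open>Symmetry of the double functions via their generating series\<close>

definition fps_subst :: "('v \<Rightarrow> ('w, 'r) mpoly) \<Rightarrow> ('v, 'r::comm_ring_1) mpoly fps \<Rightarrow> ('w, 'r) mpoly fps" where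
  "fps_subst s F = Abs_fps (\<lambda>m. subst s (F $ m))"

lemma fps_subst_mult: "fps_subst s (F * G) = fps_subst s F * fps_subst s G"
  by (rule fps_ext) (simp add: fps_subst_def fps_mult_nth subst_sum subst_mult)

lemma fps_subst_1: "fps_subst s 1 = 1"
  by (rule fps_ext) (simp add: fps_subst_def)

lemma fps_subst_prod: "fps_subst s (\<Prod>i\<in>I. F i) = (\<Prod>i\<in>I. fps_subst s (F i))"
  by (induction I rule: infinite_finite_induct) (simp_all add: fps_subst_mult fps_subst_1)

lemma fps_subst_lin: "fps_subst s (lin c) = lin (subst s c)"
  by (rule fps_ext) (simp add: fps_subst_def lin_def subst_add fps_X_def)

lemma fps_subst_geo: "fps_subst s (geo c) = geo (subst s c)"
  by (rule fps_ext) (simp add: fps_subst_def geo_def subst_power)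

text \<open>A permutation only reorders the factors 1 + x_i t; the factors containing
  \<open>b\<close> form a separate product free of the x_i.\<close>

lemma gen_e_symmetric:
  assumes "\<pi> permutes {1..n}"
  shows "subst (\<lambda>i. Var (\<pi> i)) (gen_e b n $ m) = gen_e b n $ m"
proof -
  have "fps_subst (\<lambda>i. Var (\<pi> i)) (gen_e b n) =
      (\<Prod>i=1..n. lin (Var (\<pi> i))) * (\<Prod>i=1..n. geo (- Coeff (b (int i))))"
    by (simp only: gen_e_def fps_subst_prod fps_subst_mult fps_subst_lin fps_subst_geo
        subst_Var subst_uminus subst_Coeff prod.distrib)
  also have "(\<Prod>i=1..n. lin (Var (\<pi> i))) = (\<Prod>i=1..n. lin (Var i))"
    using prod.permute[OF assms, of "\<lambda>i. lin (Var i)"] unfolding o_def by (rule sym)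
  finally have "fps_subst (\<lambda>i. Var (\<pi> i)) (gen_e b n) = gen_e b n"
    by (simp add: gen_e_def prod.distrib)
  then show ?thesis by (metis fps_nth_Abs_fps fps_subst_def)
qed

lemma gen_h_symmetric:
  assumes "\<pi> permutes {1..n}"
  shows "subst (\<lambda>i. Var (\<pi> i)) (gen_h b n $ m) = gen_h b n $ m"
proof -
  have "fps_subst (\<lambda>i. Var (\<pi> i)) (gen_h b n) =
      (\<Prod>i=1..n. lin (- Coeff (b (int i)))) * (\<Prod>i=1..n. geo (Var (\<pi> i)))"
    by (simp only: gen_h_def fps_subst_prod fps_subst_mult fps_subst_lin fps_subst_geo
        subst_Var subst_uminus subst_Coeff prod.distrib)
  also have "(\<Prod>i=1..n. geo (Var (\<pi> i))) = (\<Prod>i=1..n. geo (Var i))"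
    using prod.permute[OF assms, of "\<lambda>i. geo (Var i)"] unfolding o_def by (rule sym)
  finally have "fps_subst (\<lambda>i. Var (\<pi> i)) (gen_h b n) = gen_h b n"
    by (simp add: gen_h_def prod.distrib)
  then show ?thesis by (metis fps_nth_Abs_fps fps_subst_def)
qed

text \<open>The relation can be solved for \<open>e m\<close>: the lower \<open>e k\<close> are
  fixed by induction and their coefficients are constants.\<close>

lemma triangular_subst_invariant:
  fixes e g :: "nat \<Rightarrow> ('v, 'r::comm_ring_1) mpoly"
  assumes "\<And>m. g m = e m + (\<Sum>k<m. Coeff (c m k) * e k)" "\<And>m. subst s (g m) = g m"
  shows "subst s (e m) = e m"
proof (induction m rule: less_induct)
  case (less m)
  have "subst s (g m) = subst s (e m) + (\<Sum>k<m. Coeff (c m k) * e k)"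
    unfolding assms(1) by (simp add: subst_add subst_sum subst_mult less)
  then show ?case using assms(1)[of m] assms(2)[of m] by simp
qed

lemma symmetric_poly_double_e: "symmetric_poly n (double_e k b n)"
proof -
  obtain c where "\<And>m. gen_e b n $ m = double_e m b n + (\<Sum>k<m. Coeff (c m k) * double_e k b n)"
    using gen_triangular[of b] by blast
  then have "subst (\<lambda>i. Var (\<pi> i)) (double_e k b n) = double_e k b n" if "\<pi> permutes {1..n}" for \<pi>
    by (rule triangular_subst_invariant) (rule gen_e_symmetric[OF that])
  then show ?thesis by (simp add: symmetric_poly_iff vars_double_e[simplified])
qed

lemma symmetric_poly_double_h: "symmetric_poly n (double_h k b n)"
proof -
  obtain c where "\<And>m. gen_h b n $ m = double_h m b n + (\<Sum>k<m. Coeff (c m k) * double_h k b n)"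
    using gen_triangular[of "dual_seq b"] unfolding dual_seq_dual_seq by blast
  then have "subst (\<lambda>i. Var (\<pi> i)) (double_h k b n) = double_h k b n" if "\<pi> permutes {1..n}" for \<pi>
    by (rule triangular_subst_invariant) (rule gen_h_symmetric[OF that])
  then show ?thesis by (simp add: symmetric_poly_iff vars_double_h[simplified])
qed

section \<open>Leading monomials of products of the e_k, and algebraic independence\<close>

definition column :: "nat \<Rightarrow> nat \<Rightarrow> (nat \<Rightarrow>\<^sub>0 nat)" where
  "column k a = (\<Sum>i=1..k. Poly_Mapping.single i a)"

lemma lookup_column: "Poly_Mapping.lookup (column k a) i = (if 1 \<le> i \<and> i \<le> k then a else 0)"
  by (simp add: column_def lookup_sum lookup_single when_def)

lemma deg_sum: "deg (\<Sum>i\<in>I. f i) = (\<Sum>i\<in>I. deg (f i))"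
  by (induction I rule: infinite_finite_induct) (simp_all add: deg_add)

lemma deg_column: "deg (column k a) = k * a"
  by (simp add: column_def deg_sum)

lemma column_Suc: "column (Suc k) a = column k a + Poly_Mapping.single (Suc k) a"
  by (simp add: column_def)

lemma double_e_gt: "n < k \<Longrightarrow> double_e k b n = 0"
proof (induction n arbitrary: k b)
  case 0
  then show ?case by (cases k) simp_all
next
  case (Suc n)
  then show ?case by (cases k) (simp_all add: double_e_Suc)
qed

text \<open>In the step to n+1 variables the second summand has leading monomial x_1 ... x_{k-1}
  x_{n+1}. This is below x_1 ... x_k if k \<le> n; for k = n+1 the first summand is zero.\<close>

lemma monic_at_double_e: "k \<le> n \<Longrightarrow> monic_at (column k 1) (double_e k b n)"
proof (induction n arbitrary: k b)
  case 0
  then show ?case by (simp add: column_def monic_at_1)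
next
  case (Suc n)
  show ?case
  proof (cases k)
    case 0
    then show ?thesis by (simp add: column_def monic_at_1)
  next
    case k: (Suc l)
    let ?x = "Poly_Mapping.single (Suc n) 1"
      and ?q = "(Var (Suc n) - Coeff (b (int (Suc n)))) * double_e l (shift b) n"
    have q: "monic_at (?x + column l 1) ?q"
      using Suc k by (intro monic_at_mult monic_at_Var_minus_Coeff) auto
    show ?thesis
    proof (cases "k \<le> n")
      case True
      have "grlex (?x + column l 1) < grlex (column k 1)"
      proof (rule grlex_lessI[of _ _ k])
        show "deg (?x + column l 1) = deg (column k 1)" by (simp add: deg_add deg_column k)
      qed (use True k in \<open>auto simp: lookup_add lookup_single lookup_column\<close>)
      then show ?thesis
        using monic_at_add_low[OF Suc.IH[OF True] monic_at_imp_low[OF q]] by (simp add: k double_e_Suc)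
    next
      case False
      then have "l = n" using Suc.prems k by simp
      with q show ?thesis
        by (simp add: k double_e_Suc double_e_gt column_Suc add.commute)
    qed
  qed
qed

lemma column_add: "column k (a + a') = column k a + column k a'"
  by (simp add: column_def single_add sum.distrib)

lemma monic_at_power: "monic_at (column k 1) p \<Longrightarrow> monic_at (column k a) (p ^ a)"
proof (induction a)
  case 0
  then show ?case by (simp add: column_def monic_at_1)
next
  case (Suc a)
  then have "monic_at (column k 1 + column k a) (p * p ^ a)" by (intro monic_at_mult) auto
  then show ?case using column_add[of k 1 a] by simp
qed

text \<open>A monomial \<open>g\<close> encodes the product of the powers of e_{k+1} with exponents
  g_k; the index moves by one since e_0 = 1 is no generator. The leading monomial has exponent g_j +
  g_{j+1} + ... at x_{j+1}: the conjugate of the partition with g_k parts equal to k+1.\<close>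

definition lead :: "(nat \<Rightarrow>\<^sub>0 nat) \<Rightarrow> (nat \<Rightarrow>\<^sub>0 nat)" where
  "lead g = (\<Sum>k\<in>Poly_Mapping.keys g. column (Suc k) (Poly_Mapping.lookup g k))"

lemma monic_at_monom_eval:
  "Poly_Mapping.keys g \<subseteq> {..<n} \<Longrightarrow>
     monic_at (lead g) (monom_eval (\<lambda>k. double_e (Suc k) b n) g)"
  unfolding lead_def monom_eval_def
  by (intro monic_at_prod monic_at_power monic_at_double_e) auto

lemma lookup_lead_0 [simp]: "Poly_Mapping.lookup (lead g) 0 = 0"
  by (simp add: lead_def lookup_sum lookup_column)

lemma lookup_lead_Suc:
  "Poly_Mapping.lookup (lead g) (Suc j) =
     Poly_Mapping.lookup g j + Poly_Mapping.lookup (lead g) (Suc (Suc j))"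
proof -
  let ?K = "Poly_Mapping.keys g" and ?l = "Poly_Mapping.lookup g"
  have "Poly_Mapping.lookup (lead g) (Suc j) = (\<Sum>k\<in>?K. if j \<le> k then ?l k else 0)"
    by (simp add: lead_def lookup_sum lookup_column)
  also have "\<dots> = (\<Sum>k\<in>?K. (if k = j then ?l k else 0) + (if Suc j \<le> k then ?l k else 0))"
    by (rule sum.cong) auto
  also have "\<dots> = ?l j + Poly_Mapping.lookup (lead g) (Suc (Suc j))"
    by (simp add: sum.distrib lead_def lookup_sum lookup_column in_keys_iff)
  finally show ?thesis .
qed

lemma lead_inject: "lead g = lead g' \<Longrightarrow> g = g'"
  by (rule poly_mapping_eqI) (metis lookup_lead_Suc add_right_cancel)

text \<open>A factor e_{k+1} alone contributes k+1 to the degree. This bounds the generators that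
  occur by the degree, uniformly in \<open>n\<close>.\<close>

lemma keys_less_deg_lead:
  assumes "k \<in> Poly_Mapping.keys g" shows "k < deg (lead g)"
proof -
  have "deg (lead g) = (\<Sum>k\<in>Poly_Mapping.keys g. Suc k * Poly_Mapping.lookup g k)"
    by (simp add: lead_def deg_sum deg_column)
  also have "\<dots> \<ge> Suc k * Poly_Mapping.lookup g k"
    using assms by (intro member_le_sum) auto
  moreover have "Suc k * Poly_Mapping.lookup g k \<ge> Suc k * 1"
    using assms by (intro mult_le_mono2) (simp add: in_keys_iff)
  ultimately show ?thesis by simp
qed

text \<open>Different monomials of \<open>G\<close> have different leading monomials after
  substitution, so the largest of these cannot cancel. The bound on the variables excludes the e_k
  with k > n, which are zero.\<close>

lemma double_e_independent:
  assumes "vars G \<subseteq> {..<n}" "subst (\<lambda>k. double_e (Suc k) b n) G = 0"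
  shows "G = 0"
proof (rule ccontr)
  assume "G \<noteq> 0"
  let ?K = "Poly_Mapping.keys G" and ?E = "monom_eval (\<lambda>k. double_e (Suc k) b n)"
  have K: "?K \<noteq> {}" using \<open>G \<noteq> 0\<close> by simp
  have "Max ((grlex \<circ> lead) ` ?K) \<in> (grlex \<circ> lead) ` ?K"
    using K by (intro Max_in) auto
  then obtain g where g: "g \<in> ?K" "grlex (lead g) = Max ((grlex \<circ> lead) ` ?K)" by auto
  have mx: "grlex (lead g') \<le> grlex (lead g)" if "g' \<in> ?K" for g'
    unfolding g(2) using that by (intro Max_ge) auto
  have E: "monic_at (lead g') (?E g')" if "g' \<in> ?K" for g'
    using that assms(1) by (intro monic_at_monom_eval) (auto simp: vars_def)
  have "Poly_Mapping.lookup (?E g') (lead g) = (if g' = g then 1 else 0)" if "g' \<in> ?K" for g'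
  proof (cases "g' = g")
    case True
    then show ?thesis using E[OF that] by (simp add: lookup_monic_at)
  next
    case False
    then have "lead g \<notin> Poly_Mapping.keys (?E g')"
      using monic_at_keys[OF E[OF that]] mx[OF that] lead_inject by force
    then show ?thesis using False by (simp add: in_keys_iff)
  qed
  then have "Poly_Mapping.lookup G g' * Poly_Mapping.lookup (?E g') (lead g) =
      (if g' = g then Poly_Mapping.lookup G g' else 0)" if "g' \<in> ?K" for g'
    using that by auto
  then have "Poly_Mapping.lookup (subst (\<lambda>k. double_e (Suc k) b n) G) (lead g) =
      (\<Sum>g'\<in>?K. if g' = g then Poly_Mapping.lookup G g' else 0)"
    unfolding subst_def monom_eval_def[symmetric] lookup_sum lookup_Coeff_mult
    by (rule sum.cong[OF refl])
  also have "\<dots> = Poly_Mapping.lookup G g" using g(1) by simp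
  finally show False using assms(2) g(1) by (simp add: in_keys_iff)
qed

section \<open>Symmetric polynomials as polynomials in the e_k\<close>

lemma lookup_map_key: "inj f \<Longrightarrow> Poly_Mapping.lookup (Poly_Mapping.map_key f m) w = Poly_Mapping.lookup m (f w)"
  by (simp add: Poly_Mapping.map_key.rep_eq)

text \<open>\<open>map_key\<close> pulls exponents back, whereas renaming variables pushes them
  forward; for a transposition, being its own inverse, the two agree.\<close>

lemma symmetric_poly_transpose_keys:
  assumes "symmetric_poly n p" "i \<in> {1..n}" "j \<in> {1..n}" "m \<in> Poly_Mapping.keys p"
  shows "Poly_Mapping.map_key (transpose i j) m \<in> Poly_Mapping.keys p"
proof -
  let ?t = "transpose i j" let ?T = "Poly_Mapping.map_key ?t"
  have inj: "inj ?t" by simp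
  have T_inj: "?T m' = ?T m'' \<longleftrightarrow> m' = m''" for m' m'' :: "nat \<Rightarrow>\<^sub>0 nat"
    by (metis inj lookup_map_key poly_mapping_eqI transpose_involutory)
  have mon: "monom_eval (\<lambda>v. Var (?t v)) m' = Poly_Mapping.single (?T m') (1::qa)" for m'
  proof -
    have "Poly_Mapping.keys (?T m') = ?t ` Poly_Mapping.keys m'"
      unfolding Poly_Mapping.keys_map_key[OF inj]
      by (auto simp: image_iff) (metis transpose_involutory)
    then have "monom_eval (\<lambda>v. Var (?t v)) m' = (monom_eval Var (?T m') :: xpoly)"
      unfolding monom_eval_def by (simp add: prod.reindex inj_on_subset[OF inj] lookup_map_key)
    then show ?thesis by (simp add: monom_eval_Var)
  qed
  have "p = subst (\<lambda>v. Var (?t v)) p"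
    using assms by (simp add: symmetric_poly_iff permutes_swap_id)
  then have "Poly_Mapping.lookup p (?T m) = Poly_Mapping.lookup (subst (\<lambda>v. Var (?t v)) p) (?T m)"
    by simp
  also have "\<dots> = Poly_Mapping.lookup p m"
    unfolding subst_def monom_eval_def[symmetric] mon
    using assms(4) by (simp add: lookup_sum lookup_Coeff_mult lookup_single T_inj when_def if_distrib cong: if_cong)
  finally show ?thesis using assms(4) by (simp add: in_keys_iff)
qed

text \<open>Were the exponent at i+1 larger than that at i, exchanging x_i and x_{i+1} would give a
  monomial of \<open>p\<close> of the same degree that is larger at i, the first place of
  difference.\<close>

lemma symmetric_poly_leading_antitone:
  assumes "symmetric_poly n p" "m \<in> Poly_Mapping.keys p"
    and max: "\<And>k. k \<in> Poly_Mapping.keys p \<Longrightarrow> grlex k \<le> grlex m" and "i \<ge> 1"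
  shows "Poly_Mapping.lookup m (Suc i) \<le> Poly_Mapping.lookup m i"
proof (cases "Suc i \<le> n")
  case False
  moreover have "Poly_Mapping.keys m \<subseteq> {1..n}" using assms(1,2) by (simp add: symmetric_poly_def)
  ultimately have "Suc i \<notin> Poly_Mapping.keys m" by auto
  then show ?thesis by (simp add: in_keys_iff)
next
  case True
  let ?t = "transpose i (Suc i)" let ?m = "Poly_Mapping.map_key ?t m"
  have inj: "inj ?t" by simp
  show ?thesis
  proof (rule ccontr)
    assume *: "\<not> ?thesis"
    have sub: "Poly_Mapping.keys k \<subseteq> {1..n}" if "k \<in> Poly_Mapping.keys p" for k
      using that assms(1) by (auto simp: symmetric_poly_def)
    have mem: "?m \<in> Poly_Mapping.keys p"
      using assms True by (intro symmetric_poly_transpose_keys) auto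
    have perm: "?t permutes {1..n}" using True assms(4) by (intro permutes_swap_id) auto
    have "grlex m < grlex ?m"
    proof (rule grlex_lessI[of _ _ i])
      have "deg ?m = (\<Sum>v=1..n. Poly_Mapping.lookup m (?t v))"
        using deg_superset[OF _ sub[OF mem]] by (simp add: lookup_map_key[OF inj])
      also have "\<dots> = (\<Sum>v=1..n. Poly_Mapping.lookup m v)"
        using sum.permute[OF perm, of "Poly_Mapping.lookup m"] unfolding o_def by (rule sym)
      also have "\<dots> = deg m"
        by (rule deg_superset[symmetric]) (use sub[OF assms(2)] in auto)
      finally show "deg m = deg ?m" ..
      show "Poly_Mapping.lookup m i < Poly_Mapping.lookup ?m i"
        using * by (simp add: lookup_map_key)
    qed (simp add: lookup_map_key transpose_def)
    with max[OF mem] show False by simp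
  qed
qed

text \<open>\<open>lead\<close> is inverted by taking differences of consecutive exponents; the
  subtraction of naturals is exact by the second assumption.\<close>

lemma lead_surj:
  assumes "Poly_Mapping.keys m \<subseteq> {1..n}"
    "\<And>i. i \<ge> 1 \<Longrightarrow> Poly_Mapping.lookup m (Suc i) \<le> Poly_Mapping.lookup m i"
  obtains g where "lead g = m" "Poly_Mapping.keys g \<subseteq> {..<n}"
proof
  let ?f = "\<lambda>k. Poly_Mapping.lookup m (Suc k) - Poly_Mapping.lookup m (Suc (Suc k))"
  define g where "g = Abs_poly_mapping ?f"
  have z: "Poly_Mapping.lookup m (Suc k) = 0" if "k \<ge> n" for k
    using assms(1) that by (auto simp: in_keys_iff)
  have sub: "{k. ?f k \<noteq> 0} \<subseteq> {..<n}"
    using z by (metis (mono_tags, lifting) diff_0_eq_0 lessThan_iff linorder_not_le mem_Collect_eq subsetI)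
  then have "finite {k. ?f k \<noteq> 0}" by (rule finite_subset) simp
  then have g: "Poly_Mapping.lookup g k = ?f k" for k by (simp add: g_def)
  then show kg: "Poly_Mapping.keys g \<subseteq> {..<n}" using sub by (auto simp: in_keys_iff)
  have "Poly_Mapping.lookup (lead g) (Suc j) = Poly_Mapping.lookup m (Suc j)" for j
  \<comment> \<open>Descending induction on \<open>j\<close>, starting from j \<ge> n, where both
    exponents vanish.\<close>
  proof (induction "n - j" arbitrary: j)
    case 0
    then have "Poly_Mapping.lookup (lead g) (Suc j) = 0"
      using kg by (auto simp: lead_def lookup_sum lookup_column)
    then show ?case using 0 z by simp
  next
    case (Suc l)
    then have "Poly_Mapping.lookup (lead g) (Suc (Suc j)) = Poly_Mapping.lookup m (Suc (Suc j))"
      by simp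
    then show ?case using lookup_lead_Suc[of g j] assms(2)[of "Suc j"] by (simp add: g)
  qed
  moreover have "Poly_Mapping.lookup m 0 = 0" using assms(1) by (auto simp: in_keys_iff)
  ultimately show "lead g = m"
    by (intro poly_mapping_eqI) (metis lookup_lead_0 not0_implies_Suc)
qed

lemma finite_monomials: "finite {m. Poly_Mapping.keys m \<subseteq> {1..n::nat} \<and> deg m \<le> d}" (is "finite ?M")
proof (rule finite_imageD)
  have "Poly_Mapping.lookup ` ?M \<subseteq>
      {f. \<forall>x. (x \<in> {1..n} \<longrightarrow> f x \<in> {..d}) \<and> (x \<notin> {1..n} \<longrightarrow> f x = 0)}"
  proof (intro image_subsetI CollectI allI conjI impI)
    fix m x assume m: "m \<in> ?M"
    then show "Poly_Mapping.lookup m x \<in> {..d}"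
      using lookup_le_deg[of m x] by simp
    show "Poly_Mapping.lookup m x = 0" if "x \<notin> {1..n}"
      using m that not_in_keys_iff_lookup_eq_zero[of x m] by blast
  qed
  then show "finite (Poly_Mapping.lookup ` ?M)"
    by (rule finite_subset) (intro finite_set_of_finite_funs, auto)
  show "inj_on Poly_Mapping.lookup ?M"
    by (rule inj_onI) (erule iffD2[OF poly_mapping_eq_iff])
qed

text \<open>Subtracting a scalar multiple of the product with the same leading monomial leaves only
  smaller monomials. As the order is graded, the bound \<open>d\<close> survives, and the number of
  monomials at or below some monomial of \<open>p\<close>, finite because of that bound,
  decreases.\<close>

theorem symmetric_poly_generated:
  assumes "symmetric_poly n p" "deg_le d p"
  shows "\<exists>G. vars G \<subseteq> {..<min n d} \<and> p = subst (\<lambda>k. double_e (Suc k) b n) G"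
  using assms
proof (induction "card {m. Poly_Mapping.keys m \<subseteq> {1..n} \<and> deg m \<le> d \<and>
    (\<exists>k\<in>Poly_Mapping.keys p. grlex m \<le> grlex k)}" arbitrary: p rule: less_induct)
  case less
  let ?N = "\<lambda>p. {m. Poly_Mapping.keys m \<subseteq> {1..n} \<and> deg m \<le> d \<and>
      (\<exists>k\<in>Poly_Mapping.keys (p::xpoly). grlex m \<le> grlex k)}"
  let ?E = "monom_eval (\<lambda>k. double_e (Suc k) b n)"
  show ?case
  proof (cases "p = 0")
    case True
    then show ?thesis by (intro exI[of _ 0]) simp
  next
    case False
    then have "Max (grlex ` Poly_Mapping.keys p) \<in> grlex ` Poly_Mapping.keys p"
      by (intro Max_in) auto
    then obtain m where m: "m \<in> Poly_Mapping.keys p" "grlex m = Max (grlex ` Poly_Mapping.keys p)"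
      by auto
    have mx: "grlex k \<le> grlex m" if "k \<in> Poly_Mapping.keys p" for k
      unfolding m(2) using that by (intro Max_ge) auto
    have sub: "Poly_Mapping.keys m \<subseteq> {1..n}" and md: "deg m \<le> d"
      using less.prems m(1) by (auto simp: symmetric_poly_def deg_le_def)
    obtain g where g: "lead g = m" "Poly_Mapping.keys g \<subseteq> {..<n}"
      using lead_surj[OF sub] symmetric_poly_leading_antitone[OF less.prems(1) m(1) mx] by blast
    let ?c = "Poly_Mapping.lookup p m"
    let ?q = "p - Coeff ?c * ?E g"
    have E: "monic_at m (?E g)" using monic_at_monom_eval[OF g(2), of b] g(1) by simp
    have "symmetric_poly n (subst (\<lambda>k. double_e (Suc k) b n) (Poly_Mapping.single g ?c))"
      by (intro symmetric_poly_subst symmetric_poly_double_e)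
    then have symq: "symmetric_poly n ?q"
      by (simp add: subst_single symmetric_poly_diff less.prems(1))
    have q: "grlex k < grlex m" if "k \<in> Poly_Mapping.keys ?q" for k
    proof -
      have "k \<noteq> m"
        using that lookup_monic_at[OF E] by (auto simp: in_keys_iff lookup_minus lookup_Coeff_mult)
      moreover have "k \<in> Poly_Mapping.keys p \<or> k \<in> Poly_Mapping.keys (?E g)"
        using that by (auto simp: in_keys_iff lookup_minus lookup_Coeff_mult)
      ultimately show ?thesis
        using mx[of k] monic_at_keys[OF E, of k] grlex_inject[of k m] by (auto simp: order.strict_iff_order)
    qed
    have "deg_le d ?q"
      unfolding deg_le_def
    proof
      fix k assume k: "k \<in> Poly_Mapping.keys ?q"
      then have "Poly_Mapping.keys k \<subseteq> {1..n}" using symq by (auto simp: symmetric_poly_def)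
      then have "deg k \<le> deg m"
        using grlex_less_imp_deg_le[OF q[OF k]] sub by force
      then show "deg k \<le> d" using md by simp
    qed
    moreover have "card (?N ?q) < card (?N p)"
    proof (rule psubset_card_mono)
      show "finite (?N p)" by (rule finite_subset[OF _ finite_monomials[of n d]]) auto
      have "m \<in> ?N p" using sub md m(1) by auto
      moreover have "m \<notin> ?N ?q" using q by force
      moreover have "x \<in> ?N p" if x: "x \<in> ?N ?q" for x
      proof -
        obtain k where "k \<in> Poly_Mapping.keys ?q" "grlex x \<le> grlex k" using x by blast
        with q[of k] have "grlex x \<le> grlex m" by simp
        then show ?thesis using x m(1) by blast
      qed
      ultimately show "?N ?q \<subset> ?N p" by blast
    qed
    ultimately obtain G where G: "vars G \<subseteq> {..<min n d}" "?q = subst (\<lambda>k. double_e (Suc k) b n) G"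
      using less.hyps[of ?q] symq by blast
    \<comment> \<open>The bound \<open>n\<close> comes from the choice of \<open>g\<close>, the
      bound \<open>d\<close> from the degree of its leading monomial \<open>m\<close>.\<close>
    have "vars (Poly_Mapping.single g ?c) \<subseteq> {..<min n d}"
      using g md keys_less_deg_lead[of _ g] by (force simp: vars_def split: if_splits)
    then show ?thesis
      using G by (intro exI[of _ "G + Poly_Mapping.single g ?c"])
        (auto simp: vars_add subst_add subst_single algebra_simps)
  qed
qed

subsection \<open>The ring of stable symmetric sequences\<close>

lemma Lam_iff:
  "P \<in> Lam b \<longleftrightarrow> (\<forall>n. symmetric_poly n (P n)) \<and> (\<exists>d. \<forall>n. deg_le d (P n)) \<and>
     (\<forall>n. subst (Var(Suc n := Coeff (b (int (Suc n))))) (P (Suc n)) = P n)"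
proof -
  have "(\<forall>n\<ge>1. Q n) \<longleftrightarrow> (\<forall>n. Q (Suc n))" for Q
    by (metis One_nat_def Suc_le_D Suc_le_mono le0)
  then show ?thesis by (simp add: Lam_def deg_le_def deg_def)
qed

lemma Lam_Coeff: "(\<lambda>n. Coeff c) \<in> Lam b"
  by (simp add: Lam_iff)

lemma Lam_1: "(\<lambda>n. 1) \<in> Lam b"
  using Lam_Coeff[of 1] by simp

lemma Lam_add: "P \<in> Lam b \<Longrightarrow> Q \<in> Lam b \<Longrightarrow> (\<lambda>n. P n + Q n) \<in> Lam b"
  unfolding Lam_iff
  by (auto simp: symmetric_poly_add subst_add)
     (metis deg_le_add deg_le_mono max.cobounded1 max.cobounded2)

lemma Lam_mult: "P \<in> Lam b \<Longrightarrow> Q \<in> Lam b \<Longrightarrow> (\<lambda>n. P n * Q n) \<in> Lam b"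
  unfolding Lam_iff
  by (auto simp: symmetric_poly_mult subst_mult) (metis deg_le_mult)

lemma Lam_Coeff_mult: "P \<in> Lam b \<Longrightarrow> (\<lambda>n. Coeff c * P n) \<in> Lam b"
  by (rule Lam_mult[OF Lam_Coeff])

lemma Lam_sum: "(\<And>i. i \<in> I \<Longrightarrow> P i \<in> Lam b) \<Longrightarrow> (\<lambda>n. \<Sum>i\<in>I. P i n) \<in> Lam b"
proof (induction I rule: infinite_finite_induct)
  case (insert x F)
  then have "(\<lambda>n. P x n + (\<Sum>i\<in>F. P i n)) \<in> Lam b" by (intro Lam_add) auto
  then show ?case using insert.hyps by simp
qed (use Lam_Coeff[of 0] in simp_all)

lemma Lam_subst:
  assumes "\<And>v. s v \<in> Lam b" shows "(\<lambda>n. subst (\<lambda>v. s v n) G) \<in> Lam b"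
  by (induction G rule: mpoly_induct)
     (simp_all add: assms subst_add subst_mult Lam_Coeff Lam_add Lam_mult)

lemma double_e_Lam: "double_e k b \<in> Lam b"
  unfolding Lam_iff using symmetric_poly_double_e deg_le_double_e double_e_stable by blast

lemma double_h_Lam: "double_h k b \<in> Lam b"
  unfolding Lam_iff using symmetric_poly_double_h deg_le_double_h double_h_stable by blast

section \<open>Elements of the ring as polynomials in the generators\<close>

definition e_poly :: "(int \<Rightarrow> qa) \<Rightarrow> xpoly \<Rightarrow> nat \<Rightarrow> xpoly" where
  "e_poly b G n = subst (\<lambda>k. double_e (Suc k) b n) G"

definition h_poly :: "(int \<Rightarrow> qa) \<Rightarrow> xpoly \<Rightarrow> nat \<Rightarrow> xpoly" where
  "h_poly b G n = subst (\<lambda>k. double_h (Suc k) b n) G"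

lemma e_poly_Lam: "e_poly b G \<in> Lam b"
  unfolding e_poly_def by (rule Lam_subst) (rule double_e_Lam)

lemma h_poly_Lam: "h_poly b G \<in> Lam b"
  unfolding h_poly_def by (rule Lam_subst) (rule double_h_Lam)

lemma e_poly_inject_at:
  assumes "vars G \<subseteq> {..<n}" "vars H \<subseteq> {..<n}" "e_poly b G n = e_poly b H n"
  shows "G = H"
proof -
  have "G - H = 0"
  proof (rule double_e_independent)
    show "vars (G - H) \<subseteq> {..<n}" using assms by (simp add: vars_diff)
    show "subst (\<lambda>k. double_e (Suc k) b n) (G - H) = 0"
      using assms(3) by (simp add: e_poly_def subst_diff)
  qed
  then show ?thesis by simp
qed

lemma e_poly_inject: "e_poly b G = e_poly b H \<Longrightarrow> G = H"
proof -
  assume eq: "e_poly b G = e_poly b H"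
  have "finite (vars G \<union> vars H)" by (simp add: finite_vars)
  then obtain n where "vars G \<union> vars H \<subseteq> {..<n}"
    unfolding finite_nat_set_iff_bounded by auto
  with eq show ?thesis by (intro e_poly_inject_at[of G n H b]) auto
qed

text \<open>The polynomial \<open>G\<close> found with \<open>d\<close> variables fits every
  component. Above \<open>d\<close>, the polynomial \<open>H\<close> of that component again uses
  only the first \<open>d\<close> generators; one component lower it has the same value as
  \<open>G\<close>, so independence there forces H = G. Below \<open>d\<close>, stability carries
  the equality down.\<close>

theorem e_poly_surj:
  assumes "P \<in> Lam b"
  obtains G where "P = e_poly b G"
proof -
  obtain d where symm: "\<And>n. symmetric_poly n (P n)" and d: "\<And>n. deg_le d (P n)"
    and stable: "\<And>n. subst (Var(Suc n := Coeff (b (int (Suc n))))) (P (Suc n)) = P n"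
    using assms unfolding Lam_iff by blast
  have ex: "\<exists>G. vars G \<subseteq> {..<min n d} \<and> P n = e_poly b G n" for n
    unfolding e_poly_def by (rule symmetric_poly_generated[OF symm d])
  have stable_e: "subst (Var(Suc n := Coeff (b (int (Suc n))))) (e_poly b G (Suc n)) = e_poly b G n" for G n
    using e_poly_Lam[of b G] unfolding Lam_iff by blast
  from ex[of d] obtain G where G: "vars G \<subseteq> {..<d}" "P d = e_poly b G d" by auto
  have above: "P (d + j) = e_poly b G (d + j)" for j
  proof (induction j)
    case (Suc j)
    from ex[of "Suc (d + j)"] obtain H
      where H: "vars H \<subseteq> {..<d}" "P (Suc (d + j)) = e_poly b H (Suc (d + j))" by auto
    have "e_poly b H (d + j) = P (d + j)"
      using stable[of "d + j"] stable_e[of "d + j" H] unfolding H(2) by (rule trans[OF sym, rotated])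
    then have "e_poly b H (d + j) = e_poly b G (d + j)" using Suc by (rule trans)
    moreover have "{..<d} \<subseteq> {..<d + j}" by simp
    ultimately have "H = G"
      using e_poly_inject_at[OF subset_trans[OF H(1)] subset_trans[OF G(1)]] by blast
    then show ?case using H(2) by simp
  qed (simp add: G)
  have below: "P (d - j) = e_poly b G (d - j)" for j
  proof (induction j)
    case (Suc j)
    show ?case
    proof (cases "j < d")
      case True
      then have "d - j = Suc (d - Suc j)" by simp
      with Suc have "P (Suc (d - Suc j)) = e_poly b G (Suc (d - Suc j))" by simp
      then show ?thesis
        using stable[of "d - Suc j"] stable_e[of "d - Suc j" G] by (simp del: of_nat_Suc)
    qed (use Suc in simp)
  qed (simp add: G)
  have "P n = e_poly b G n" for n
    using above[of "n - d"] below[of "d - n"] by (cases "n \<le> d") simp_all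
  then have "P = e_poly b G" by blast
  then show thesis by (rule that)
qed

lemma e_poly_Var: "e_poly b (Var k) = double_e (Suc k) b"
  by (rule ext) (simp add: e_poly_def)

lemma h_poly_Var: "h_poly b (Var k) = double_h (Suc k) b"
  by (rule ext) (simp add: h_poly_def)

subsection \<open>Homomorphisms\<close>

lemma
  assumes "Lam_hom b c f"
  shows Lam_hom_in: "P \<in> Lam b \<Longrightarrow> f P \<in> Lam c"
    and Lam_hom_1: "f (\<lambda>n. 1) = (\<lambda>n. 1)"
    and Lam_hom_add: "P \<in> Lam b \<Longrightarrow> Q \<in> Lam b \<Longrightarrow> f (\<lambda>n. P n + Q n) = (\<lambda>n. f P n + f Q n)"
    and Lam_hom_mult: "P \<in> Lam b \<Longrightarrow> Q \<in> Lam b \<Longrightarrow> f (\<lambda>n. P n * Q n) = (\<lambda>n. f P n * f Q n)"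
    and Lam_hom_Coeff_mult: "P \<in> Lam b \<Longrightarrow> f (\<lambda>n. Coeff r * P n) = (\<lambda>n. Coeff r * f P n)"
  using assms unfolding Lam_hom_def by auto

lemma Lam_hom_Coeff: "Lam_hom b c f \<Longrightarrow> f (\<lambda>n. Coeff r) = (\<lambda>n. Coeff r)"
  using Lam_hom_Coeff_mult[OF _ Lam_1, of b c f r] by (simp add: Lam_hom_1)

lemma Lam_hom_sum:
  assumes "Lam_hom b c f" "\<And>i. i \<in> I \<Longrightarrow> P i \<in> Lam b"
  shows "f (\<lambda>n. \<Sum>i\<in>I. P i n) = (\<lambda>n. \<Sum>i\<in>I. f (P i) n)"
  using assms(2)
proof (induction I rule: infinite_finite_induct)
  case (insert x F)
  have "f (\<lambda>n. P x n + (\<Sum>i\<in>F. P i n)) = (\<lambda>n. f (P x) n + f (\<lambda>n. \<Sum>i\<in>F. P i n) n)"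
    using insert by (intro Lam_hom_add[OF assms(1)] Lam_sum) auto
  then show ?case using insert by simp
qed (use Lam_hom_Coeff[OF assms(1), of 0] in simp_all)

lemma Lam_hom_subst:
  assumes "Lam_hom b c f" "\<And>v. s v \<in> Lam b"
  shows "f (\<lambda>n. subst (\<lambda>v. s v n) G) = (\<lambda>n. subst (\<lambda>v. f (s v) n) G)"
proof (induction G rule: mpoly_induct)
  case (Coeff r)
  then show ?case by (simp add: Lam_hom_Coeff[OF assms(1)])
next
  case (add p q)
  then show ?case
    using Lam_hom_add[OF assms(1) Lam_subst[of s, OF assms(2)] Lam_subst[of s, OF assms(2)], of p q]
    by (simp add: subst_add)
next
  case (mult p q)
  then show ?case
    using Lam_hom_mult[OF assms(1) Lam_subst[of s, OF assms(2)] Lam_subst[of s, OF assms(2)], of p q]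
    by (simp add: subst_mult)
qed simp

lemma Lam_hom_e_poly:
  assumes "Lam_hom b c f" "\<And>k. k \<ge> 1 \<Longrightarrow> f (double_e k b) = double_h k c"
  shows "f (e_poly b G) = h_poly c G"
  using Lam_hom_subst[OF assms(1), of "\<lambda>k. double_e (Suc k) b" G] assms(2)
  by (simp add: double_e_Lam e_poly_def[abs_def] h_poly_def[abs_def])

text \<open>Coordinates with respect to the e_k exist and are unique, so \<open>f\<close> can
  substitute the h_k of b' into them; being a substitution, it is a homomorphism. Any competitor
  agrees with it on every \<open>e_poly b G\<close>. This gives the \<open>THE\<close> in
  \<open>omega\<close> its meaning.\<close>

lemma omega_ex1:
  "\<exists>!f. f \<in> extensional (Lam b) \<and> Lam_hom b (dual_seq b) f \<and>
     (\<forall>k\<ge>1. f (double_e k b) = double_h k (dual_seq b))"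
proof -
  define f where "f = restrict (\<lambda>P. h_poly (dual_seq b) (THE G. P = e_poly b G)) (Lam b)"
  have f: "f (e_poly b G) = h_poly (dual_seq b) G" for G
  proof -
    have "(THE H. e_poly b G = e_poly b H) = G" by (rule the_equality) (auto dest: e_poly_inject)
    then show ?thesis by (simp add: f_def e_poly_Lam)
  qed
  have "Lam_hom b (dual_seq b) f"
    unfolding Lam_hom_def
  proof (intro conjI ballI allI)
    show "f \<in> Lam b \<rightarrow> Lam (dual_seq b)"
      by (auto simp: f_def h_poly_Lam)
    have 1: "e_poly b 1 = (\<lambda>n. 1)" "h_poly (dual_seq b) 1 = (\<lambda>n. 1)"
      by (simp_all add: e_poly_def h_poly_def fun_eq_iff)
    then show "f (\<lambda>n. 1) = (\<lambda>n. 1)" using f[of 1] by simp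
  next
    fix P Q assume "P \<in> Lam b" "Q \<in> Lam b"
    then obtain G H where GH: "P = e_poly b G" "Q = e_poly b H" by (meson e_poly_surj)
    have "(\<lambda>n. P n + Q n) = e_poly b (G + H)" "(\<lambda>n. P n * Q n) = e_poly b (G * H)"
      by (simp_all add: GH e_poly_def subst_add subst_mult fun_eq_iff)
    then show "f (\<lambda>n. P n + Q n) = (\<lambda>n. f P n + f Q n)" "f (\<lambda>n. P n * Q n) = (\<lambda>n. f P n * f Q n)"
      by (simp_all add: f GH) (simp_all add: h_poly_def subst_add subst_mult fun_eq_iff)
  next
    fix r P assume "P \<in> Lam b"
    then obtain G where G: "P = e_poly b G" by (rule e_poly_surj)
    have "(\<lambda>n. Coeff r * P n) = e_poly b (Coeff r * G)"
      by (simp add: G e_poly_def subst_mult fun_eq_iff)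
    then show "f (\<lambda>n. Coeff r * P n) = (\<lambda>n. Coeff r * f P n)"
      by (simp add: f G) (simp add: h_poly_def subst_mult fun_eq_iff)
  qed
  moreover have "f (double_e k b) = double_h k (dual_seq b)" if "k \<ge> 1" for k
    using that f[of "Var (k - 1)"] by (simp add: e_poly_Var h_poly_Var)
  moreover have "f \<in> extensional (Lam b)" by (simp add: f_def)
  moreover have "g = f" if g: "g \<in> extensional (Lam b)" "Lam_hom b (dual_seq b) g"
    "\<forall>k\<ge>1. g (double_e k b) = double_h k (dual_seq b)" for g
  proof (rule extensionalityI[OF g(1)])
    show "f \<in> extensional (Lam b)" by (simp add: f_def)
    fix P assume "P \<in> Lam b"
    then obtain G where "P = e_poly b G" by (rule e_poly_surj)
    then show "g P = f P" using Lam_hom_e_poly[OF g(2), of G] g(3) f by simp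
  qed
  ultimately show ?thesis by blast
qed

lemma
  shows omega_hom: "Lam_hom b (dual_seq b) (omega b)"
    and omega_double_e_pos: "k \<ge> 1 \<Longrightarrow> omega b (double_e k b) = double_h k (dual_seq b)"
proof -
  have "omega b \<in> extensional (Lam b) \<and> Lam_hom b (dual_seq b) (omega b) \<and>
      (\<forall>k\<ge>1. omega b (double_e k b) = double_h k (dual_seq b))"
    unfolding omega_def by (rule theI'[OF omega_ex1])
  then show "Lam_hom b (dual_seq b) (omega b)"
    "k \<ge> 1 \<Longrightarrow> omega b (double_e k b) = double_h k (dual_seq b)" by blast+
qed

lemma omega_double_e: "omega b (double_e k b) = double_h k (dual_seq b)"
proof (cases "k = 0")
  case True
  have "double_e 0 b = (\<lambda>n. 1)" "double_h 0 (dual_seq b) = (\<lambda>n. 1)" by (simp_all add: fun_eq_iff)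
  then show ?thesis using True Lam_hom_1[OF omega_hom, of b] by simp
qed (simp add: omega_double_e_pos)

subsection \<open>The image of the complete functions\<close>

text \<open>This is F(-t).\<close>

definition alt :: "'r::comm_ring_1 fps \<Rightarrow> 'r fps" where
  "alt F = Abs_fps (\<lambda>m. (- 1) ^ m * F $ m)"

lemma alt_mult: "alt (F * G) = alt F * alt G"
proof (rule fps_ext)
  fix m
  have "(- 1) ^ m * (F $ i * G $ (m - i)) = (- 1) ^ i * F $ i * ((- 1) ^ (m - i) * G $ (m - i))"
    if "i \<le> m" for i
  proof -
    have "(- 1 :: 'a) ^ m = (- 1) ^ i * (- 1) ^ (m - i)"
      using that by (simp flip: power_add)
    then show ?thesis by (simp only: mult_ac)
  qed
  then show "alt (F * G) $ m = (alt F * alt G) $ m"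
    by (simp add: alt_def fps_mult_nth sum_distrib_left)
qed

lemma alt_alt [simp]: "alt (alt F) = F"
  by (rule fps_ext) (simp add: alt_def flip: mult.assoc power_mult_distrib)

lemma alt_1 [simp]: "alt 1 = 1"
  by (rule fps_ext) (simp add: alt_def)

lemma alt_prod: "alt (\<Prod>i\<in>I. F i) = (\<Prod>i\<in>I. alt (F i))"
  by (induction I rule: infinite_finite_induct) (simp_all add: alt_mult)

lemma alt_lin: "alt (lin c) = lin (- c)"
  by (rule fps_ext) (simp add: alt_def lin_def fps_X_def)

lemma alt_geo: "alt (geo c) = geo (- c)"
  by (rule fps_ext) (simp add: alt_def geo_def flip: power_mult_distrib)

lemma gen_e_alt_gen_h: "gen_e b n * alt (gen_h b n) = 1"
proof -
  have "gen_e b n * alt (gen_h b n) =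
     (\<Prod>i=1..n. (lin (Var i) * geo (- Var i)) * (lin (Coeff (b (int i))) * geo (- Coeff (b (int i)))))"
    unfolding gen_e_def gen_h_def alt_prod alt_mult alt_lin alt_geo prod.distrib[symmetric]
      minus_minus by (simp only: mult_ac)
  then show ?thesis by (simp add: lin_geo')
qed

lemma gen_e_Lam: "(\<lambda>n. gen_e b n $ m) \<in> Lam b"
  and omega_gen_e: "omega b (\<lambda>n. gen_e b n $ m) = (\<lambda>n. gen_h (dual_seq b) n $ m)"
proof -
  obtain c where c: "\<And>m n. gen_e b n $ m = double_e m b n + (\<Sum>k<m. Coeff (c m k) * double_e k b n)"
    "\<And>m n. gen_h (dual_seq b) n $ m = double_h m (dual_seq b) n +
      (\<Sum>k<m. Coeff (c m k) * double_h k (dual_seq b) n)"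
    using gen_triangular[of b] by blast
  have *: "(\<lambda>n. Coeff (c m k) * double_e k b n) \<in> Lam b" for k
    by (intro Lam_Coeff_mult double_e_Lam)
  show "(\<lambda>n. gen_e b n $ m) \<in> Lam b"
    unfolding c(1) by (intro Lam_add double_e_Lam Lam_sum *)
  show "omega b (\<lambda>n. gen_e b n $ m) = (\<lambda>n. gen_h (dual_seq b) n $ m)"
    unfolding c Lam_hom_add[OF omega_hom double_e_Lam Lam_sum[OF *]]
      Lam_hom_sum[OF omega_hom *] Lam_hom_Coeff_mult[OF omega_hom double_e_Lam] omega_double_e ..
qed

text \<open>Membership is inherited from \<open>gen_e\<close> of b', whose coefficients
  \<open>omega\<close> of b' maps to these elements, because b'' = b.\<close>

lemma gen_h_Lam: "(\<lambda>n. gen_h b n $ m) \<in> Lam b"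
proof -
  have "(\<lambda>n. gen_h (dual_seq (dual_seq b)) n $ m) \<in> Lam (dual_seq (dual_seq b))"
    unfolding omega_gen_e[symmetric] by (rule Lam_hom_in[OF omega_hom gen_e_Lam])
  then show ?thesis by simp
qed

text \<open>The homomorphism turns u(t) v(-t) = 1 into an equation that makes the unknown images
  \<open>W\<close> inverse to v(-t) for b'. That inverse is u(t) for b'.\<close>

lemma omega_gen_h: "omega b (\<lambda>n. gen_h b n $ m) = (\<lambda>n. gen_e (dual_seq b) n $ m)"
proof -
  \<comment> \<open>\<open>omega b\<close> acts on whole sequences, so \<open>W n\<close> collects
    the n-th components of the images. The product identity below is therefore stated as an equality
    of functions of \<open>n\<close> before \<open>omega b\<close> is applied.\<close>
  define W where "W n = Abs_fps (\<lambda>m. omega b (\<lambda>n. gen_h b n $ m) n)" for n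
  have "gen_h (dual_seq b) n * alt (W n) = 1" for n
  proof (rule fps_ext)
    fix m
    \<comment> \<open>The sign of v(-t) is written as a scalar so that linearity moves it past
      \<open>omega b\<close>.\<close>
    let ?t = "\<lambda>i n. Coeff ((- 1) ^ (m - i)) * (gen_e b n $ i * gen_h b n $ (m - i))"
    have t: "?t i \<in> Lam b" for i
      by (intro Lam_Coeff_mult Lam_mult gen_e_Lam gen_h_Lam)
    have "(\<Sum>i=0..m. ?t i n) = (gen_e b n * alt (gen_h b n)) $ m" for n
      by (simp add: fps_mult_nth alt_def Coeff_power Coeff_uminus mult_ac)
    then have "(\<lambda>n. \<Sum>i=0..m. ?t i n) = (\<lambda>n. Coeff (if m = 0 then 1 else 0))"
      unfolding gen_e_alt_gen_h by auto
    then have "omega b (\<lambda>n. \<Sum>i=0..m. ?t i n) = (\<lambda>n. Coeff (if m = 0 then 1 else 0))"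
      by (simp only: Lam_hom_Coeff[OF omega_hom])
    moreover have "omega b (\<lambda>n. \<Sum>i=0..m. ?t i n) = (\<lambda>n. \<Sum>i=0..m. Coeff ((- 1) ^ (m - i)) *
        (gen_h (dual_seq b) n $ i * W n $ (m - i)))"
      unfolding Lam_hom_sum[OF omega_hom t] Lam_hom_Coeff_mult[OF omega_hom Lam_mult[OF gen_e_Lam gen_h_Lam]]
        Lam_hom_mult[OF omega_hom gen_e_Lam gen_h_Lam] omega_gen_e W_def by simp
    ultimately have "(\<lambda>n. \<Sum>i=0..m. Coeff ((- 1) ^ (m - i)) *
        (gen_h (dual_seq b) n $ i * W n $ (m - i))) = (\<lambda>n. Coeff (if m = 0 then 1 else 0))"
      by (rule trans[OF sym, rotated])
    from fun_cong[OF this, of n]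
    have "(\<Sum>i=0..m. Coeff ((- 1) ^ (m - i)) * (gen_h (dual_seq b) n $ i * W n $ (m - i))) =
        Coeff (if m = 0 then 1 else 0)" .
    then show "(gen_h (dual_seq b) n * alt (W n)) $ m = 1 $ m"
      by (simp add: fps_mult_nth alt_def Coeff_power Coeff_uminus mult_ac split: if_splits)
  qed
  then have "alt (gen_h (dual_seq b) n * alt (W n)) = 1" for n by simp
  then have alt: "alt (gen_h (dual_seq b) n) * W n = 1" for n by (simp only: alt_mult alt_alt)
  have "W n = gen_e (dual_seq b) n" for n
  proof -
    have "W n = gen_e (dual_seq b) n * (alt (gen_h (dual_seq b) n) * W n)"
      unfolding mult.assoc[symmetric] gen_e_alt_gen_h by simp
    then show ?thesis unfolding alt by simp
  qed
  then have "omega b (\<lambda>n. gen_h b n $ m) n = gen_e (dual_seq b) n $ m" for n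
    unfolding W_def by (simp add: fps_eq_iff)
  then show ?thesis by (rule ext)
qed

text \<open>\<open>gen_triangular\<close> at b' expresses v for b and u for b' by the same
  coefficients. Once the smaller indices are settled, \<open>omega_gen_h\<close> leaves only the
  diagonal term.\<close>

lemma omega_double_h: "omega b (double_h m b) = double_e m (dual_seq b)"
proof (induction m rule: less_induct)
  case (less m)
  obtain c where c: "\<And>m n. gen_e (dual_seq b) n $ m =
      double_e m (dual_seq b) n + (\<Sum>k<m. Coeff (c m k) * double_e k (dual_seq b) n)"
    "\<And>m n. gen_h b n $ m = double_h m b n + (\<Sum>k<m. Coeff (c m k) * double_h k b n)"
    using gen_triangular[of "dual_seq b"] unfolding dual_seq_dual_seq by blast
  have *: "(\<lambda>n. Coeff (c m k) * double_h k b n) \<in> Lam b" for k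
    by (intro Lam_Coeff_mult double_h_Lam)
  have "omega b (\<lambda>n. gen_h b n $ m) =
      (\<lambda>n. omega b (double_h m b) n + (\<Sum>k<m. Coeff (c m k) * omega b (double_h k b) n))"
    unfolding c(2) Lam_hom_add[OF omega_hom double_h_Lam Lam_sum[OF *]]
      Lam_hom_sum[OF omega_hom *] Lam_hom_Coeff_mult[OF omega_hom double_h_Lam] ..
  also have "\<dots> = (\<lambda>n. omega b (double_h m b) n + (\<Sum>k<m. Coeff (c m k) * double_e k (dual_seq b) n))"
    using less by simp
  finally show ?case
    unfolding omega_gen_h c(1) by (simp add: fun_eq_iff)
qed

lemma double_h_part_Lam: "double_h_part l b \<in> Lam b"
  and omega_double_h_part: "omega b (double_h_part l b) = double_e_part l (dual_seq b)"
proof (induction l)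
  case Nil
  have "double_h_part [] b = (\<lambda>n. 1)" "double_e_part [] (dual_seq b) = (\<lambda>n. 1)"
    by (rule ext, simp add: double_h_part_def double_e_part_def)+
  then show "double_h_part [] b \<in> Lam b" "omega b (double_h_part [] b) = double_e_part [] (dual_seq b)"
    using Lam_1 Lam_hom_1[OF omega_hom] by simp_all
next
  case (Cons k l)
  have "double_h_part (k # l) b = (\<lambda>n. double_h k b n * double_h_part l b n)"
    "double_e_part (k # l) (dual_seq b) = (\<lambda>n. double_e k (dual_seq b) n * double_e_part l (dual_seq b) n)"
    by (rule ext, simp add: double_h_part_def double_e_part_def)+
  then show "double_h_part (k # l) b \<in> Lam b"
    "omega b (double_h_part (k # l) b) = double_e_part (k # l) (dual_seq b)"
    using Cons by (simp_all add: Lam_mult double_h_Lam Lam_hom_mult[OF omega_hom] omega_double_h)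
qed

text \<open>The coordinate polynomial \<open>G\<close> is kept throughout: it is evaluated at the
  e_k of b, at the h_k of b', and at the e_k of b'' = b.\<close>

lemma omega_omega:
  assumes "P \<in> Lam b" shows "omega (dual_seq b) (omega b P) = P"
proof -
  obtain G where G: "P = e_poly b G" using assms by (rule e_poly_surj)
  have "omega b P = h_poly (dual_seq b) G"
    unfolding G by (rule Lam_hom_e_poly[OF omega_hom omega_double_e])
  moreover have "omega (dual_seq b) (h_poly (dual_seq b) G) = e_poly b G"
    using Lam_hom_subst[OF omega_hom, of "\<lambda>k. double_h (Suc k) (dual_seq b)" "dual_seq b" G]
    by (simp add: double_h_Lam omega_double_h e_poly_def[abs_def] h_poly_def[abs_def])
  ultimately show ?thesis using G by simp
qed

theorem proposition2p3:
  "(\<forall>P\<in>Lam indet. omega (dual_seq indet) (omega indet P) = P) \<and>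
   (\<forall>l. is_partition l \<longrightarrow>
      omega indet (double_h_part l indet) = double_e_part l (dual_seq indet))"
  using omega_omega omega_double_h_part by blast

end
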